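(* Let $G$ be a graph homeomorphic to the union of a round circle (in a plane) and two parallel chords of it (each chord joining two points of the circle). For every $\varepsilon>0$ there exists a knotted piecewise linear embedding of $G$ in $\mathbb{R}^3$, with image $\Gamma_\varepsilon$, such that $$\mu(\Gamma_\varepsilon)<1+\varepsilon .$$
   Context: The two chords are disjoint, distinct and nondegenerate. An embedding of $G$ in $\mathbb{R}^3$ is knotted if it is not (ambient) isotopic to a planar embedding of $G$, i.e. to an embedding with image in an affine plane of $\mathbb{R}^3$. For $u\in S^2$ let $h_u(x)=(u,x)$ (Euclidean inner product). For a piecewise linearly embedded finite graph $\Gamma\subset\mathbb{R}^3$ and almost every $u\in S^2$ (namely those $u$ not orthogonal to any of the finitely many line segments of $\Gamma$), let $\mu(u)$ be the number of local minima of the restriction $h_u|_\Gamma$. The crookedness is $\mu(\Gamma)=\frac1{4\pi}\int_{S^2}\mu(u)\,|d\sigma(u)|$, with $|d\sigma|$ the Euclidean area density on $S^2$. *)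

theory Defs
  imports "HOL-Analysis.Analysis"
begin

section \<open>The graph: a round circle with two parallel chords\<close>

text \<open>Here \<open>a\<close>, \<open>b\<close> and \<open>p\<close>, \<open>q\<close> are the end points of the two chords of the circle with
  centre \<open>c\<close> and radius \<open>r\<close>. Disjointness of the closed chords implies that they are distinct.\<close>

definition disjoint_parallel_chords ::
    "real^2 \<Rightarrow> real \<Rightarrow> real^2 \<Rightarrow> real^2 \<Rightarrow> real^2 \<Rightarrow> real^2 \<Rightarrow> bool" where
  "disjoint_parallel_chords c r a b p q \<longleftrightarrow>
     {a, b, p, q} \<subseteq> sphere c r \<and> a \<noteq> b \<and> p \<noteq> q \<and>
     (\<exists>k::real. q - p = k *\<^sub>R (b - a)) \<and>
     closed_segment a b \<inter> closed_segment p q = {}"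

definition circle_with_two_parallel_chords :: "(real^2) set \<Rightarrow> bool" where
  "circle_with_two_parallel_chords K \<longleftrightarrow>
     (\<exists>c r a b p q. r > 0 \<and> disjoint_parallel_chords c r a b p q \<and>
        K = sphere c r \<union> closed_segment a b \<union> closed_segment p q)"

section \<open>Embeddings in Euclidean 3-space\<close>

definition embedding_on :: "'a::topological_space set \<Rightarrow> ('a \<Rightarrow> real^3) \<Rightarrow> bool" where
  "embedding_on G f \<longleftrightarrow> (\<exists>g. homeomorphism G (f ` G) f g)"

text \<open>A graph that is given only up to homeomorphism carries no distinguished linear structure on
  its edges, so an embedding is piecewise linear when \<open>G\<close> can be cut into finitely many pieces, each
  of which is mapped onto a line segment (which may degenerate to a point).\<close>

definition pl_embedding_on :: "'a::topological_space set \<Rightarrow> ('a \<Rightarrow> real^3) \<Rightarrow> bool" where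
  "pl_embedding_on G f \<longleftrightarrow> embedding_on G f \<and>
     (\<exists>\<A>. finite \<A> \<and> \<Union>\<A> = G \<and> (\<forall>A\<in>\<A>. \<exists>x y. f ` A = closed_segment x y))"

definition planar_embedding_on :: "'a::topological_space set \<Rightarrow> ('a \<Rightarrow> real^3) \<Rightarrow> bool" where
  "planar_embedding_on G f \<longleftrightarrow> embedding_on G f \<and>
     (\<exists>P. affine P \<and> aff_dim P = 2 \<and> f ` G \<subseteq> P)"

text \<open>The homotopy runs through self-homeomorphisms of the ambient space, starting at the identity.
  Joint continuity of the inverses is automatic by invariance of domain.\<close>

definition ambient_isotopic_on ::
    "'a set \<Rightarrow> ('a \<Rightarrow> real^3) \<Rightarrow> ('a \<Rightarrow> real^3) \<Rightarrow> bool" where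
  "ambient_isotopic_on G f g \<longleftrightarrow>
     (\<exists>\<Phi> :: real^3 \<Rightarrow> real^3.
        homotopic_with_canon (\<lambda>h. \<exists>k. homeomorphism UNIV UNIV h k) UNIV UNIV id \<Phi> \<and>
        (\<forall>x\<in>G. g x = \<Phi> (f x)))"

definition knotted_on :: "'a::topological_space set \<Rightarrow> ('a \<Rightarrow> real^3) \<Rightarrow> bool" where
  "knotted_on G f \<longleftrightarrow> embedding_on G f \<and>
     \<not> (\<exists>g. planar_embedding_on G g \<and> ambient_isotopic_on G f g)"

section \<open>Crookedness\<close>

definition spherical_coords :: "real \<times> real \<Rightarrow> real^3" where
  "spherical_coords = (\<lambda>(\<theta>, \<phi>). vector [sin \<theta> * cos \<phi>, sin \<theta> * sin \<phi>, cos \<theta>])"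

text \<open>Surface area of the unit sphere, as a Borel measure on the ambient space concentrated on the
  sphere. The density \<open>sin \<theta>\<close> is the norm of the cross product of the two partial derivatives of
  the parametrisation.\<close>

definition sphere_area :: "(real^3) measure" where
  "sphere_area =
     distr (density lborel (\<lambda>(\<theta>, \<phi>). indicator ({0..pi} \<times> {0..2 * pi}) (\<theta>, \<phi>) * ennreal (sin \<theta>)))
       borel spherical_coords"

lemma spherical_coords_measurable [measurable]: "spherical_coords \<in> borel_measurable borel"
proof -
  have eq: "spherical_coords = (\<lambda>x. (sin (fst x) * cos (snd x)) *\<^sub>R axis 1 1
      + (sin (fst x) * sin (snd x)) *\<^sub>R axis 2 1 + cos (fst x) *\<^sub>R axis 3 1)"
    by (auto simp: spherical_coords_def fun_eq_iff vec_eq_iff forall_3 axis_def)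
  show ?thesis
    unfolding eq by (intro borel_measurable_continuous_onI continuous_intros)
qed

lemma nn_integral_sphere_area:
  assumes [measurable]: "f \<in> borel_measurable borel"
  shows "(\<integral>\<^sup>+ u. f u \<partial>sphere_area) =
    (\<integral>\<^sup>+ \<theta>\<in>{0..pi}. (\<integral>\<^sup>+ \<phi>\<in>{0..2 * pi}. f (spherical_coords (\<theta>, \<phi>)) \<partial>lborel) * ennreal (sin \<theta>) \<partial>lborel)"
proof -
  let ?I = "\<lambda>x::real \<times> real. indicator ({0..pi} \<times> {0..2 * pi}) x * ennreal (sin (fst x))"
  have [measurable]: "fst \<in> borel_measurable (borel :: (real \<times> real) measure)"
    by (intro borel_measurable_continuous_onI continuous_intros)
  have [measurable]: "{0..pi} \<times> {0..2 * pi} \<in> sets (borel :: (real \<times> real) measure)"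
    by (intro borel_closed closed_Times) auto
  have meas: "(\<lambda>x. ?I x * f (spherical_coords x)) \<in> borel_measurable borel"
    by measurable
  have meas2: "(\<lambda>\<phi>::real. f (spherical_coords (\<theta>, \<phi>))) \<in> borel_measurable borel" for \<theta>
  proof -
    have "(\<lambda>\<phi>::real. (\<theta>, \<phi>)) \<in> borel_measurable borel"
      by (intro borel_measurable_continuous_onI continuous_intros)
    then show ?thesis by measurable
  qed
  have "(\<integral>\<^sup>+ u. f u \<partial>sphere_area) = (\<integral>\<^sup>+ x. ?I x * f (spherical_coords x) \<partial>lborel)"
    unfolding sphere_area_def case_prod_beta'
    by (simp add: nn_integral_distr nn_integral_density)
  also have "\<dots> = (\<integral>\<^sup>+ \<theta>. (\<integral>\<^sup>+ \<phi>. ?I (\<theta>, \<phi>) * f (spherical_coords (\<theta>, \<phi>)) \<partial>lborel) \<partial>lborel)"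
    using meas
    by (subst lborel_prod[symmetric], subst lborel.nn_integral_fst[symmetric])
       (simp_all add: lborel_prod)
  also have "\<dots> = (\<integral>\<^sup>+ \<theta>\<in>{0..pi}.
      (\<integral>\<^sup>+ \<phi>\<in>{0..2 * pi}. f (spherical_coords (\<theta>, \<phi>)) \<partial>lborel) * ennreal (sin \<theta>) \<partial>lborel)"
  proof (rule nn_integral_cong)
    fix \<theta> :: real
    have "(\<integral>\<^sup>+ \<phi>. ?I (\<theta>, \<phi>) * f (spherical_coords (\<theta>, \<phi>)) \<partial>lborel)
        = (\<integral>\<^sup>+ \<phi>. (indicator {0..pi} \<theta> * ennreal (sin \<theta>)) *
            (f (spherical_coords (\<theta>, \<phi>)) * indicator {0..2 * pi} \<phi>) \<partial>lborel)"
      by (intro nn_integral_cong) (simp add: indicator_times mult_ac)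
    also have "\<dots> = (indicator {0..pi} \<theta> * ennreal (sin \<theta>)) *
        (\<integral>\<^sup>+ \<phi>. f (spherical_coords (\<theta>, \<phi>)) * indicator {0..2 * pi} \<phi> \<partial>lborel)"
      using meas2[of \<theta>] by (subst nn_integral_cmult) auto
    finally show "(\<integral>\<^sup>+ \<phi>. ?I (\<theta>, \<phi>) * f (spherical_coords (\<theta>, \<phi>)) \<partial>lborel)
        = (\<integral>\<^sup>+ \<phi>\<in>{0..2 * pi}. f (spherical_coords (\<theta>, \<phi>)) \<partial>lborel) * ennreal (sin \<theta>)
            * indicator {0..pi} \<theta>"
      by (simp add: mult_ac)
  qed
  finally show ?thesis .
qed

lemma emeasure_sphere_area: "emeasure sphere_area UNIV = ennreal (4 * pi)"
proof -
  have "emeasure sphere_area UNIV = (\<integral>\<^sup>+ u. 1 \<partial>sphere_area)"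
    by (simp add: sphere_area_def)
  also have "\<dots> = (\<integral>\<^sup>+ \<theta>\<in>{0..pi}. ennreal (2 * pi * sin \<theta>) \<partial>lborel)"
    by (subst nn_integral_sphere_area) (auto simp: ennreal_mult' intro!: nn_integral_cong)
  also have "\<dots> = ennreal (- (2 * pi) * cos pi - (- (2 * pi) * cos 0))"
    by (rule nn_integral_FTC_Icc)
       (auto intro!: derivative_eq_intros mult_nonneg_nonneg sin_ge_zero)
  finally show ?thesis by simp
qed

definition local_minima :: "(real^3) set \<Rightarrow> real^3 \<Rightarrow> (real^3) set" where
  "local_minima \<Gamma> u = {x \<in> \<Gamma>. \<forall>\<^sub>F y in at x within \<Gamma>. inner u x \<le> inner u y}"

text \<open>For a piecewise linear \<open>\<Gamma>\<close> the set of local minima is finite unless \<open>u\<close> is orthogonal to one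
  of its segments; those exceptional directions form a null set, so the value that
  \<^const>\<open>card\<close> assigns to infinite sets is immaterial. The nonnegative integral avoids the
  junk value of the Bochner integral.\<close>

definition crookedness :: "(real^3) set \<Rightarrow> ennreal" where
  "crookedness \<Gamma> =
     (\<integral>\<^sup>+ u. of_nat (card (local_minima \<Gamma> u)) \<partial>sphere_area) / ennreal (4 * pi)"

end

theory Submission
  imports Defs
begin

text \<open>
  The graph contains two disjoint cycles, each made of a chord and the arc of the circle that it
  cuts off, and two more arcs that connect them. In a planar embedding disjoint cycles are unlinked,
  so an embedding in which the two cycles are linked is knotted. Linking costs no crookedness:
  each cycle consists of two paths between the same two vertices, and these can all run monotonically
  along a common axis while one path of one cycle passes through the disc that the other cycle
  spans. Four monotone strands suffice for a clasp.

  The graph \<open>knot_graph d\<close> is such an embedding with two triangles as cycles, squeezed by the factor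
  \<open>d\<close> towards the axis. As soon as a direction makes an angle larger than a multiple of \<open>d\<close> with
  the plane orthogonal to the axis, the height function is strictly monotone on all edges and has
  a single local minimum, at one end of the graph. The remaining directions form a band on the
  sphere whose area is a multiple of \<open>d\<close>, and there the number of local minima is bounded by the
  number of edges. So the crookedness tends to 1 as \<open>d\<close> tends to 0 (\<open>crookedness_knot_graph\<close>).

  That linked cycles cannot be flattened by a homeomorphism of space has the following reason. A cycle in a
  plane contracts in the complement of any set in that plane disjoint from it, because it can first be pushed off
  the plane (\<open>disjoint_coplanar_nullhomotopic\<close>). A homeomorphism would carry this contraction
  back to the linked cycles. But one triangle \<open>T\<close> is the zero set of an explicit function
  \<open>F\<close> to the complex numbers, and along the other triangle \<open>F\<close> winds once around 0, so that it
  has no continuous logarithm there (\<open>no_log_around_zero\<close>, \<open>linked_not_planar\<close>).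

  It remains to map the given graph onto \<open>knot_graph d\<close>. A similarity makes the chords vertical and
  the circle a unit circle (\<open>circle_with_two_parallel_chords_homeomorphic\<close>), and an explicit
  continuous injection does the rest, as the source is compact
  (\<open>chorded_circle_homeomorphic_knot_graph\<close>).
\<close>

section \<open>Linking as an obstruction to planarity\<close>

text \<open>Two disjoint sets in a plane are unlinked in a very strong sense, whatever their shape: push the
  first one off the plane, which frees it from the second, and contract it inside the parallel
  plane. Nesting of the two sets within the plane is no obstacle.\<close>

lemma disjoint_coplanar_nullhomotopic:
  fixes \<Phi> :: "'a::topological_space \<Rightarrow> 'b::real_normed_vector"
  assumes "affine P" "P \<noteq> UNIV" "continuous_on A \<Phi>" "\<Phi> ` A \<subseteq> P" "T \<subseteq> P" "\<Phi> ` A \<inter> T = {}"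
  shows "\<exists>c. homotopic_with_canon (\<lambda>_. True) A (- T) \<Phi> (\<lambda>_. c)"
proof (cases "A = {}")
  case True
  then show ?thesis by (simp add: homotopic_on_emptyI)
next
  case False
  then obtain x0 where x0: "x0 \<in> A" by blast
  obtain y where y: "y \<notin> P" using \<open>P \<noteq> UNIV\<close> by blast
  \<comment> \<open>a direction that leaves the plane from every one of its points\<close>
  define n where "n = y - \<Phi> x0"
  have P0: "\<Phi> x0 \<in> P" using x0 assms by blast
  have off: "x + t *\<^sub>R n \<notin> P" if "x \<in> P" "t \<noteq> 0" for x t
  proof
    assume "x + t *\<^sub>R n \<in> P"
    with \<open>affine P\<close> P0 have "\<Phi> x0 + (1 / t) *\<^sub>R (x + t *\<^sub>R n - x) \<in> P"
      using \<open>x \<in> P\<close> by (rule mem_affine_3_minus)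
    then show False using y \<open>t \<noteq> 0\<close> by (simp add: n_def)
  qed
  have "homotopic_with_canon (\<lambda>_. True) A (- T) \<Phi> (\<lambda>x. \<Phi> x + n)"
  proof (rule homotopic_with_linear)
    show "closed_segment (\<Phi> x) (\<Phi> x + n) \<subseteq> - T" if "x \<in> A" for x
    proof
      fix z assume "z \<in> closed_segment (\<Phi> x) (\<Phi> x + n)"
      then obtain t where z: "z = \<Phi> x + t *\<^sub>R n"
        by (auto simp: closed_segment_def algebra_simps)
      show "z \<in> - T"
        using off[of "\<Phi> x" t] assms that z by (cases "t = 0") auto
    qed
  qed (use assms in \<open>auto intro!: continuous_intros\<close>)
  moreover have "homotopic_with_canon (\<lambda>_. True) A (- T) (\<lambda>x. \<Phi> x + n) (\<lambda>x. \<Phi> x0 + n)"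
  proof (rule homotopic_with_linear)
    show "closed_segment (\<Phi> x + n) (\<Phi> x0 + n) \<subseteq> - T" if "x \<in> A" for x
    proof
      fix z assume "z \<in> closed_segment (\<Phi> x + n) (\<Phi> x0 + n)"
      then obtain t where z: "z = ((1 - t) *\<^sub>R \<Phi> x + t *\<^sub>R \<Phi> x0) + 1 *\<^sub>R n"
        by (auto simp: closed_segment_def algebra_simps)
      have "(1 - t) *\<^sub>R \<Phi> x + t *\<^sub>R \<Phi> x0 \<in> P"
        using assms that P0 by (intro mem_affine) auto
      then show "z \<in> - T" using off[of _ 1] z assms by fastforce
    qed
  qed (use assms in \<open>auto intro!: continuous_intros\<close>)
  ultimately show ?thesis
    using homotopic_with_trans by blast
qed

text \<open>\<open>\<alpha>\<close> will be a continuous argument along an arc that stays in the upper half plane and leads from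
  the positive to the negative real axis: the sign of the sine confines it to a single interval
  \<open>[2k\<pi>, (2k+1)\<pi>]\<close>, so it gains exactly \<open>\<pi>\<close>.\<close>

lemma half_turn:
  fixes \<alpha> :: "'a::topological_space \<Rightarrow> real"
  assumes "connected U" "continuous_on U \<alpha>" "s \<in> U" "t \<in> U"
    and nonneg: "\<And>x. x \<in> U \<Longrightarrow> 0 \<le> sin (\<alpha> x)"
    and t: "sin (\<alpha> t) = 0" "0 < cos (\<alpha> t)"
    and s: "sin (\<alpha> s) = 0" "cos (\<alpha> s) < 0"
  shows "\<alpha> s = \<alpha> t + pi"
proof -
  have "connected (\<alpha> ` U)"
    using assms connected_continuous_image by blast
  then have between: "y \<in> \<alpha> ` U" if "min (\<alpha> s) (\<alpha> t) \<le> y" "y \<le> max (\<alpha> s) (\<alpha> t)" for y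
    using that \<open>s \<in> U\<close> \<open>t \<in> U\<close> connectedD_interval[of "\<alpha> ` U" "\<alpha> s" "\<alpha> t" y]
      connectedD_interval[of "\<alpha> ` U" "\<alpha> t" "\<alpha> s" y]
    by (cases "\<alpha> s \<le> \<alpha> t") (auto simp: min_def max_def)
  have cost: "cos (\<alpha> t) = 1"
    using t sin_cos_squared_add[of "\<alpha> t"] by (simp add: power2_eq_1_iff)
  have coss: "cos (\<alpha> s) = - 1"
    using s sin_cos_squared_add[of "\<alpha> s"] by (simp add: power2_eq_1_iff)
  have rel: "0 \<le> sin (y - \<alpha> t)" if "y \<in> \<alpha> ` U" for y
    using that nonneg t cost by (auto simp: sin_diff)
  have cosd: "cos (\<alpha> s - \<alpha> t) = - 1"
    using t s cost coss by (simp add: cos_diff)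
  have ge: "\<alpha> t \<le> \<alpha> s"
  proof (rule ccontr)
    assume neg: "\<not> ?thesis"
    \<comment> \<open>a value attained on the arc, at which the argument lies in the lower half plane\<close>
    define y where "y = max (\<alpha> s) (\<alpha> t - pi / 2)"
    have "0 \<le> sin (y - \<alpha> t)"
      by (intro rel between) (use neg in \<open>auto simp: y_def\<close>)
    moreover have "sin (y - \<alpha> t) < 0"
      using sin_gt_zero[of "\<alpha> t - y"] sin_minus[of "\<alpha> t - y"] neg pi_gt_zero
      by (auto simp: y_def max_def)
    ultimately show False by simp
  qed
  have le: "\<alpha> s \<le> \<alpha> t + pi"
  proof (rule ccontr)
    assume neg: "\<not> ?thesis"
    \<comment> \<open>as before, on the other side of the interval\<close>
    define y where "y = min (\<alpha> s) (\<alpha> t + 3 * pi / 2)"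
    have "0 \<le> sin (y - \<alpha> t)"
      by (intro rel between; unfold y_def; use neg ge pi_gt_zero in linarith)
    moreover have "sin (y - \<alpha> t) < 0"
      by (rule sin_lt_zero) (use neg pi_gt_zero in \<open>auto simp: y_def min_def\<close>)
    ultimately show False by simp
  qed
  have "\<alpha> s - \<alpha> t = pi"
    by (rule cos_inj_pi) (use ge le cosd in auto)
  then show ?thesis by simp
qed

text \<open>A closed curve made of one arc in the upper and one in the lower half plane winds once around \<open>0\<close>
  when it crosses the real axis on both sides of \<open>0\<close>: along one arc the argument gains \<open>\<pi>\<close>,
  along the other it would have to lose \<open>\<pi>\<close> between the same two points.\<close>

lemma no_log_around_zero:
  fixes f g :: "'a::topological_space \<Rightarrow> complex"
  assumes "connected U" "connected L" "s \<in> U \<inter> L" "t \<in> U \<inter> L"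
    and "\<And>x. x \<in> U \<Longrightarrow> 0 \<le> Im (f x)" "\<And>x. x \<in> L \<Longrightarrow> Im (f x) \<le> 0"
    and "Re (f t) > 0" "Re (f s) < 0"
    and "continuous_on (U \<union> L) g"
  shows "\<not> (\<forall>x\<in>U \<union> L. f x = exp (g x))"
proof
  assume fg: "\<forall>x\<in>U \<union> L. f x = exp (g x)"
  have im: "Im (f x) = exp (Re (g x)) * sin (Im (g x))"
    and re: "Re (f x) = exp (Re (g x)) * cos (Im (g x))" if "x \<in> U \<union> L" for x
    using fg that by (auto simp: Im_exp Re_exp)
  have "Im (f s) = 0" "Im (f t) = 0"
    using assms(3-6) by (metis IntD1 IntD2 order_antisym)+
  then have st: "sin (Im (g s)) = 0" "sin (Im (g t)) = 0"
      "cos (Im (g s)) < 0" "cos (Im (g t)) > 0"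
    using im[of s] im[of t] re[of s] re[of t] assms(3,4,7,8)
    by (auto simp: mult_less_0_iff zero_less_mult_iff)
  have "Im (g s) = Im (g t) + pi"
  proof (rule half_turn[of U "\<lambda>x. Im (g x)"])
    show "0 \<le> sin (Im (g x))" if "x \<in> U" for x
      using assms(5)[OF that] im[of x] that by (auto simp: zero_le_mult_iff)
  qed (use assms st in \<open>auto intro!: continuous_intros intro: continuous_on_subset\<close>)
  moreover have "- Im (g s) = - Im (g t) + pi"
  proof (rule half_turn[of L "\<lambda>x. - Im (g x)"])
    show "0 \<le> sin (- Im (g x))" if "x \<in> L" for x
      using assms(6)[OF that] im[of x] that by (auto simp: mult_le_0_iff)
  qed (use assms st in \<open>auto intro!: continuous_intros intro: continuous_on_subset\<close>)
  ultimately show False by simp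
qed

text \<open>The complex function \<open>F\<close> vanishes only on \<open>T\<close>, and the winding number of \<open>F\<close> along the loop
  \<open>U \<union> L\<close> plays the role of the linking number. If \<open>\<Phi>\<close> flattened both sets, the image of the loop
  would contract off the image of \<open>T\<close>; transporting the contraction back by \<open>\<Psi>\<close> and applying \<open>F\<close>
  makes \<open>F\<close> null-homotopic on the loop, hence the exponential of a continuous function.\<close>

lemma linked_not_planar:
  fixes F :: "'a::euclidean_space \<Rightarrow> complex" and \<Phi> :: "'a \<Rightarrow> 'a"
  assumes U: "connected U" and L: "connected L" and st: "s \<in> U \<inter> L" "t \<in> U \<inter> L"
    and "\<And>x. x \<in> U \<Longrightarrow> 0 \<le> Im (F x)" "\<And>x. x \<in> L \<Longrightarrow> Im (F x) \<le> 0"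
    and "Re (F t) > 0" "Re (F s) < 0"
    and F: "continuous_on UNIV F" "\<And>x. x \<notin> T \<Longrightarrow> F x \<noteq> 0"
    and disj: "(U \<union> L) \<inter> T = {}"
    and hom: "homeomorphism UNIV UNIV \<Phi> \<Psi>"
    and P: "affine P" "P \<noteq> UNIV"
  shows "\<not> \<Phi> ` (U \<union> L \<union> T) \<subseteq> P"
proof
  assume sub: "\<Phi> ` (U \<union> L \<union> T) \<subseteq> P"
  have inv: "\<Psi> (\<Phi> x) = x" "\<Phi> (\<Psi> x) = x" for x
    using hom by (auto simp: homeomorphism_def)
  have cont: "continuous_on UNIV \<Phi>" "continuous_on UNIV \<Psi>"
    using hom by (auto simp: homeomorphism_def)
  have "\<Phi> ` (U \<union> L) \<inter> \<Phi> ` T = {}"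
    using disj inv by (metis image_Int_subset image_empty inj_on_def inj_on_image_Int subset_UNIV)
  then obtain c where
    "homotopic_with_canon (\<lambda>_. True) (U \<union> L) (- \<Phi> ` T) \<Phi> (\<lambda>_. c)"
    using disjoint_coplanar_nullhomotopic[of P "U \<union> L" \<Phi> "\<Phi> ` T"] P sub
      continuous_on_subset[OF cont(1)] by blast
  moreover have "continuous_on (- \<Phi> ` T) (F \<circ> \<Psi>)"
    by (intro continuous_on_compose continuous_on_subset[OF cont(2)] continuous_on_subset[OF F(1)]) auto
  moreover have "F \<circ> \<Psi> \<in> - \<Phi> ` T \<rightarrow> - {0}"
  proof
    fix y assume "y \<in> - \<Phi> ` T"
    then have "\<Psi> y \<notin> T" using inv by (metis ComplD imageI)
    then show "(F \<circ> \<Psi>) y \<in> - {0}" using F(2) by simp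
  qed
  ultimately have "homotopic_with_canon (\<lambda>_. True) (U \<union> L) (- {0}) ((F \<circ> \<Psi>) \<circ> \<Phi>) ((F \<circ> \<Psi>) \<circ> (\<lambda>_. c))"
    by (intro homotopic_with_compose_continuous_left) auto
  then have "\<exists>a. homotopic_with_canon (\<lambda>_. True) (U \<union> L) (- {0}) F (\<lambda>_. a)"
    using inv by (auto simp: o_def)
  then obtain g where "continuous_on (U \<union> L) g" "\<forall>x\<in>U \<union> L. F x = exp (g x)"
    unfolding inessential_eq_continuous_logarithm by blast
  with no_log_around_zero[of U L s t F g] assms show False by blast
qed

section \<open>The knotted graph\<close>

text \<open>The first coordinate of a triple becomes the last one of the vector because the polar angle of
  the spherical coordinates is measured from the third axis, which is to be the long axis of the
  graph; small \<open>d\<close> presses the graph against that axis.\<close>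

definition squeeze :: "real \<Rightarrow> real \<times> real \<times> real \<Rightarrow> real^3" where
  "squeeze d = (\<lambda>(x, y, z). vector [d * y, d * z, x])"

text \<open>The first three edges form a triangle that meets the plane \<open>z = 0\<close> in \<open>(0, 0, 0)\<close> and
  \<open>(0, 2, 0)\<close>. The next three form a triangle in that plane which has the first of these points
  inside and the second outside; so the triangles are linked. The last two edges join them. Each
  edge is directed so that the first coordinate increases by at least 1, while the other two change
  by at most 2.\<close>

definition knot_edges :: "((real \<times> real \<times> real) \<times> (real \<times> real \<times> real)) set" where
  "knot_edges =
     {((-1, 0, 1), (1, 0, -1)), ((-1, 0, 1), (0, 2, 0)), ((0, 2, 0), (1, 0, -1)),
      ((-2, -1, 0), (2, -1, 0)), ((-2, -1, 0), (0, 1, 0)), ((0, 1, 0), (2, -1, 0)),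
      ((-2, -1, 0), (-1, 0, 1)), ((1, 0, -1), (2, -1, 0))}"

definition knot_graph :: "real \<Rightarrow> (real^3) set" where
  "knot_graph d = (\<Union>(p, q)\<in>map_prod (squeeze d) (squeeze d) ` knot_edges. closed_segment p q)"

lemma squeeze_nth [simp]:
  "squeeze d (x, y, z) $ 1 = d * y" "squeeze d (x, y, z) $ 2 = d * z" "squeeze d (x, y, z) $ 3 = x"
  by (simp_all add: squeeze_def)

lemma linear_squeeze: "linear (squeeze d)"
  by (intro linearI) (auto simp: vec_eq_iff forall_3 algebra_simps)

lemma inj_squeeze: "d \<noteq> 0 \<Longrightarrow> inj (squeeze d)"
  by (auto simp: inj_on_def vec_eq_iff forall_3)

lemma knot_graph_eq: "knot_graph d = squeeze d ` (\<Union>(p, q)\<in>knot_edges. closed_segment p q)"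
  by (simp add: knot_graph_def image_UN case_prod_beta closed_segment_linear_image[OF linear_squeeze])

lemma in_edgeI:
  assumes "(p, q) \<in> knot_edges" "0 \<le> u" "u \<le> 1" "z = (1 - u) *\<^sub>R p + u *\<^sub>R q"
  shows "z \<in> (\<Union>(p, q)\<in>knot_edges. closed_segment p q)"
proof -
  have "z \<in> closed_segment p q" using assms by (auto simp: in_segment)
  with assms(1) show ?thesis by blast
qed

text \<open>The triangle in the plane \<open>z = 0\<close> is the zero set of \<open>max (-1 - y) (y + \<bar>x\<bar> - 1)\<close>, which is
  negative inside and positive outside. With \<open>z\<close> as imaginary part this gives a function on space
  that vanishes on the triangle alone and winds once around \<open>0\<close> along the other triangle.\<close>

lemma knot_graph_not_planar:
  fixes \<Phi> \<Psi> :: "real^3 \<Rightarrow> real^3"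
  assumes d: "d > 0" and "homeomorphism UNIV UNIV \<Phi> \<Psi>" "affine P" "P \<noteq> UNIV"
  shows "\<not> \<Phi> ` knot_graph d \<subseteq> P"
proof -
  let ?seg = "\<lambda>p q. closed_segment (squeeze d p) (squeeze d q)"
  let ?a = "(-1, 0, 1)" and ?b = "(1, 0, -1)" and ?m = "(0, 2, 0)"
    and ?p = "(-2, -1, 0)" and ?q = "(2, -1, 0)" and ?n = "(0, 1, 0)" and ?o = "(0, 0, 0)"
  define F :: "real^3 \<Rightarrow> complex" where
    "F = (\<lambda>v. Complex (max (- 1 - v$1 / d) (v$1 / d + \<bar>v$3\<bar> - 1)) (v$2 / d))"
  have F: "F (squeeze d (x, y, z)) = Complex (max (- 1 - y) (y + \<bar>x\<bar> - 1)) z" for x y z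
    using d by (simp add: F_def)
  have segE: "\<exists>u. 0 \<le> u \<and> u \<le> 1 \<and> v = squeeze d ((1 - u) *\<^sub>R p + u *\<^sub>R q)" if "v \<in> ?seg p q" for v p q
    using that unfolding closed_segment_linear_image[OF linear_squeeze] in_segment(1) image_iff Bex_def by blast
  define U L T where "U = ?seg ?o ?a \<union> ?seg ?a ?m" and "L = ?seg ?o ?b \<union> ?seg ?b ?m"
    and "T = ?seg ?p ?q \<union> ?seg ?p ?n \<union> ?seg ?n ?q"
  have "\<not> \<Phi> ` (U \<union> L \<union> T) \<subseteq> P"
  proof (rule linked_not_planar)
    show "connected U" "connected L"
      unfolding U_def L_def by (auto intro!: connected_Un)
    show "squeeze d ?o \<in> U \<inter> L" "squeeze d ?m \<in> U \<inter> L" by (auto simp: U_def L_def)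
    show "0 \<le> Im (F v)" if "v \<in> U" for v
      using that unfolding U_def by (auto dest!: segE simp: F)
    show "Im (F v) \<le> 0" if "v \<in> L" for v
      using that unfolding L_def by (auto dest!: segE simp: F)
    show "0 < Re (F (squeeze d ?m))" "Re (F (squeeze d ?o)) < 0" by (auto simp: F)
    show "continuous_on UNIV F"
      unfolding F_def Complex_eq using d by (intro continuous_intros) auto
    show "F v \<noteq> 0" if "v \<notin> T" for v
    proof
      assume "F v = 0"
      define x y where "x = v$3" and "y = v$1 / d"
      have F0: "v$2 / d = 0" "max (- 1 - y) (y + \<bar>x\<bar> - 1) = 0"
        using \<open>F v = 0\<close> by (auto simp: F_def x_def y_def complex_eq_iff)
      have v: "v = squeeze d (x, y, 0)"
        using d F0(1) by (auto simp: vec_eq_iff forall_3 x_def y_def)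
      have in_seg: "v \<in> ?seg p q" if "0 \<le> u" "u \<le> 1" "(x, y, 0) = (1 - u) *\<^sub>R p + u *\<^sub>R q" for u p q
        unfolding v closed_segment_linear_image[OF linear_squeeze] using that
        by (intro imageI) (auto simp: in_segment)
      have "y = -1 \<and> \<bar>x\<bar> \<le> 2 \<or> y = 1 - \<bar>x\<bar> \<and> \<bar>x\<bar> \<le> 2"
        using F0(2) by linarith
      then consider "y = -1" "\<bar>x\<bar> \<le> 2" | "y = 1 + x" "x \<le> 0" "-2 \<le> x" | "y = 1 - x" "0 \<le> x" "x \<le> 2"
        by linarith
      then have "v \<in> T"
      proof cases
        case 1
        then have "v \<in> ?seg ?p ?q"
          by (intro in_seg[of "(x + 2) / 4"]) (simp_all add: field_simps)
        then show ?thesis unfolding T_def by blast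
      next
        case 2
        then have "v \<in> ?seg ?p ?n"
          by (intro in_seg[of "(x + 2) / 2"]) (simp_all add: field_simps)
        then show ?thesis unfolding T_def by blast
      next
        case 3
        then have "v \<in> ?seg ?n ?q"
          by (intro in_seg[of "x / 2"]) (simp_all add: field_simps)
        then show ?thesis unfolding T_def by blast
      qed
      with that show False by simp
    qed
    have FT: "F v = 0" if "v \<in> T" for v
      using that unfolding T_def by (auto dest!: segE simp: F complex_eq_iff max_def abs_if)
    have FU: "F v \<noteq> 0" if "v \<in> U \<union> L" for v
      using that unfolding U_def L_def
      by (auto dest!: segE simp: F complex_eq_iff max_def abs_if split: if_splits)
    show "(U \<union> L) \<inter> T = {}" using FT FU by blast
  qed (use assms in auto)
  moreover have "U \<union> L \<union> T \<subseteq> knot_graph d"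
  proof -
    have "(0, 0, 0) \<in> closed_segment ?a ?b"
      by (auto simp: in_segment intro!: exI[of _ "1/2"])
    then have "closed_segment ?o ?a \<subseteq> closed_segment ?a ?b" "closed_segment ?o ?b \<subseteq> closed_segment ?a ?b"
      by (simp_all add: subset_closed_segment)
    then have "?seg ?o ?a \<subseteq> ?seg ?a ?b" "?seg ?o ?b \<subseteq> ?seg ?a ?b"
      unfolding closed_segment_linear_image[OF linear_squeeze] by (auto intro!: image_mono)
    moreover have "?seg p q \<subseteq> knot_graph d" if "(p, q) \<in> knot_edges" for p q
      using that unfolding knot_graph_def by force
    then have "?seg ?a ?b \<subseteq> knot_graph d" "?seg ?a ?m \<subseteq> knot_graph d" "?seg ?m ?b \<subseteq> knot_graph d"
      "T \<subseteq> knot_graph d"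
      unfolding T_def by (simp_all add: knot_edges_def)
    ultimately show ?thesis
      unfolding U_def L_def closed_segment_commute[of "squeeze d ?b"] by blast
  qed
  ultimately show ?thesis by blast
qed

section \<open>Straightening the circle and its chords\<close>

text \<open>In coordinates along and across the chords all graphs in question take this form, with chords on
  the lines \<open>x = s\<close> and \<open>x = t\<close>. These lines also cut the circle into its
  four arcs, which can therefore be told apart by the coordinates of their points.\<close>

definition chorded_circle :: "real \<Rightarrow> real \<Rightarrow> (real \<times> real) set" where
  "chorded_circle s t = {(x, y). x\<^sup>2 + y\<^sup>2 = 1 \<or> ((x = s \<or> x = t) \<and> x\<^sup>2 + y\<^sup>2 \<le> 1)}"

lemma vertical_chord:
  fixes p q :: "real \<times> real"
  assumes "fst p = s" "fst q = s" "(fst p)\<^sup>2 + (snd p)\<^sup>2 = 1" "(fst q)\<^sup>2 + (snd q)\<^sup>2 = 1" "p \<noteq> q"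
  shows "closed_segment p q = {z. fst z = s \<and> (fst z)\<^sup>2 + (snd z)\<^sup>2 \<le> 1}" "\<bar>s\<bar> < 1"
proof -
  have ne: "snd p \<noteq> snd q" using assms by (metis prod_eqI)
  have "(snd q)\<^sup>2 = (snd p)\<^sup>2" using assms by simp
  then have q: "snd q = - snd p" using ne by (auto simp: power2_eq_iff)
  then have p0: "snd p \<noteq> 0" using ne by auto
  have "s\<^sup>2 < 1" using p0 assms(1,3) by (metis add_diff_cancel_left' add.commute diff_gt_0_iff_gt zero_less_power2)
  then show "\<bar>s\<bar> < 1" by (simp add: abs_square_less_1)
  show "closed_segment p q = {z. fst z = s \<and> (fst z)\<^sup>2 + (snd z)\<^sup>2 \<le> 1}"
  proof (intro set_eqI iffI)
    fix z assume "z \<in> closed_segment p q"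
    then obtain u where u: "0 \<le> u" "u \<le> 1" "z = (1 - u) *\<^sub>R p + u *\<^sub>R q"
      by (auto simp: in_segment)
    have z: "fst z = s" "snd z = (1 - 2 * u) * snd p"
      using assms q by (auto simp: u(3) algebra_simps)
    have "(1 - 2 * u)\<^sup>2 \<le> 1" using u by (simp add: abs_square_le_1 abs_le_iff)
    then have "(snd z)\<^sup>2 \<le> (snd p)\<^sup>2"
      unfolding z power_mult_distrib by (simp add: mult_left_le_one_le)
    then show "z \<in> {z. fst z = s \<and> (fst z)\<^sup>2 + (snd z)\<^sup>2 \<le> 1}" using z assms by simp
  next
    fix z assume z: "z \<in> {z. fst z = s \<and> (fst z)\<^sup>2 + (snd z)\<^sup>2 \<le> 1}"
    define u where "u = (1 - snd z / snd p) / 2"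
    have "s\<^sup>2 + (snd z)\<^sup>2 \<le> 1" "s\<^sup>2 + (snd p)\<^sup>2 = 1" using z assms by auto
    then have "(snd z)\<^sup>2 \<le> (snd p)\<^sup>2" by linarith
    then have "\<bar>snd z / snd p\<bar> \<le> 1"
      using p0 by (simp add: abs_le_square_iff)
    then have "-1 \<le> snd z / snd p \<and> snd z / snd p \<le> 1" by linarith
    then have "0 \<le> u" "u \<le> 1" by (simp_all add: u_def)
    moreover have "z = (1 - u) *\<^sub>R p + u *\<^sub>R q"
      using z assms q p0 by (auto simp: prod_eq_iff u_def field_simps)
    ultimately show "z \<in> closed_segment p q" by (auto simp: in_segment)
  qed
qed

lemma circle_with_two_parallel_chords_homeomorphic:
  assumes "circle_with_two_parallel_chords K"
  shows "\<exists>s t. - 1 < s \<and> s < t \<and> t < 1 \<and> K homeomorphic chorded_circle s t"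
proof -
  obtain c r a b p q where r: "r > 0" and ch: "disjoint_parallel_chords c r a b p q"
    and K: "K = sphere c r \<union> closed_segment a b \<union> closed_segment p q"
    using assms unfolding circle_with_two_parallel_chords_def by blast
  obtain k where k: "q - p = k *\<^sub>R (b - a)"
    and on: "{a, b, p, q} \<subseteq> sphere c r" and ne: "a \<noteq> b" "p \<noteq> q"
    and disj: "closed_segment a b \<inter> closed_segment p q = {}"
    using ch unfolding disjoint_parallel_chords_def by blast
  define v where "v = sgn (b - a)"
  have nv: "norm v = 1" using ne by (simp add: v_def norm_sgn)
  have v: "v$1 * v$1 + v$2 * v$2 = 1"
    using nv by (simp add: norm_eq_1 inner_vec_def sum_2)
  \<comment> \<open>the similarity that takes the circle to the unit circle and the direction of the chords to the second axis\<close>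
  define T :: "real^2 \<Rightarrow> real \<times> real" where
    "T = (\<lambda>z. (((z$1 - c$1) * v$2 - (z$2 - c$2) * v$1) / r, ((z$1 - c$1) * v$1 + (z$2 - c$2) * v$2) / r))"
  define S :: "real \<times> real \<Rightarrow> real^2" where
    "S = (\<lambda>(x, y). vector [c$1 + r * (x * v$2 + y * v$1), c$2 + r * (y * v$2 - x * v$1)])"
  have T_lin: "T ((1 - u) *\<^sub>R x + u *\<^sub>R y) = (1 - u) *\<^sub>R T x + u *\<^sub>R T y" for u x y
    using r by (simp add: T_def field_simps)
  have ST: "S (T z) = z" for z
  proof -
    have "r * (((z$1 - c$1) * v$2 - (z$2 - c$2) * v$1) / r * v$2 + ((z$1 - c$1) * v$1 + (z$2 - c$2) * v$2) / r * v$1)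
       = (z$1 - c$1) * (v$1 * v$1 + v$2 * v$2)" using r by (simp add: field_simps)
    moreover have "r * (((z$1 - c$1) * v$1 + (z$2 - c$2) * v$2) / r * v$2 - ((z$1 - c$1) * v$2 - (z$2 - c$2) * v$1) / r * v$1)
       = (z$2 - c$2) * (v$1 * v$1 + v$2 * v$2)" using r by (simp add: field_simps)
    ultimately show ?thesis
      unfolding S_def T_def case_prod_conv by (simp add: vec_eq_iff forall_2 v)
  qed
  have TS: "T (S z) = z" for z
  proof -
    obtain x y where z: "z = (x, y)" by force
    have "(r * (x * v$2 + y * v$1)) * v$2 - (r * (y * v$2 - x * v$1)) * v$1 = r * x * (v$1 * v$1 + v$2 * v$2)"
      "(r * (x * v$2 + y * v$1)) * v$1 + (r * (y * v$2 - x * v$1)) * v$2 = r * y * (v$1 * v$1 + v$2 * v$2)"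
      by (simp_all add: algebra_simps)
    then show ?thesis using r by (simp add: S_def T_def z v)
  qed
  have T_norm: "(fst (T z))\<^sup>2 + (snd (T z))\<^sup>2 = (dist c z / r)\<^sup>2" for z
  proof -
    have "(dist z c)\<^sup>2 = ((z$1 - c$1)\<^sup>2 + (z$2 - c$2)\<^sup>2) * (v$1 * v$1 + v$2 * v$2)"
      by (simp add: dist_norm power2_norm_eq_inner inner_vec_def sum_2 v power2_eq_square[of "_ - _"])
    also have "\<dots> = (r * fst (T z))\<^sup>2 + (r * snd (T z))\<^sup>2"
    proof -
      have "r * fst (T z) = (z$1 - c$1) * v$2 - (z$2 - c$2) * v$1"
        "r * snd (T z) = (z$1 - c$1) * v$1 + (z$2 - c$2) * v$2"
        using r by (simp_all add: T_def)
      then show ?thesis by (simp only:) (simp add: power2_eq_square algebra_simps)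
    qed
    finally show ?thesis using r by (simp add: dist_commute power_divide power_mult_distrib field_simps)
  qed
  have circ: "z \<in> sphere c r \<longleftrightarrow> (fst (T z))\<^sup>2 + (snd (T z))\<^sup>2 = 1" for z
    using r unfolding T_norm by (auto simp: power2_eq_1_iff field_simps)
  have seg: "z \<in> closed_segment x y \<longleftrightarrow> T z \<in> closed_segment (T x) (T y)" for x y z
    unfolding in_segment T_lin[symmetric] by (metis ST)
  have par: "fst (T y) = fst (T x)" if "y - x = l *\<^sub>R (b - a)" for x y l
  proof -
    have "b - a = norm (b - a) *\<^sub>R v" using ne by (simp add: v_def sgn_div_norm)
    then have "y = x + (l * norm (b - a)) *\<^sub>R v" using that by (metis add.commute diff_add_cancel scaleR_scaleR)
    then show ?thesis by (simp add: T_def field_simps)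
  qed
  define s t where "s = fst (T a)" and "t = fst (T p)"
  have ab: "fst (T b) = s" unfolding s_def by (rule par[of _ _ 1]) simp
  have pq: "fst (T q) = t" unfolding t_def by (rule par) (rule k)
  have Tne: "T a \<noteq> T b" "T p \<noteq> T q" using ne ST by metis+
  have sc: "closed_segment (T a) (T b) = {z. fst z = s \<and> (fst z)\<^sup>2 + (snd z)\<^sup>2 \<le> 1}" "\<bar>s\<bar> < 1"
    using vertical_chord[of "T a" s "T b"] ab Tne on circ s_def by auto
  have tc: "closed_segment (T p) (T q) = {z. fst z = t \<and> (fst z)\<^sup>2 + (snd z)\<^sup>2 \<le> 1}" "\<bar>t\<bar> < 1"
    using vertical_chord[of "T p" t "T q"] pq Tne on circ t_def by auto
  have "s \<noteq> t"
  proof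
    assume "s = t"
    then have "p \<in> closed_segment a b" unfolding seg sc(1) using tc(1) by auto
    then show False using disj by auto
  qed
  have KM: "z \<in> K \<longleftrightarrow> T z \<in> chorded_circle s t" for z
    unfolding K Un_iff circ seg sc(1) tc(1) by (auto simp: chorded_circle_def case_prod_beta)
  have "homeomorphism K (chorded_circle s t) T S"
  proof (rule homeomorphismI)
    show "continuous_on K T" unfolding T_def using r by (intro continuous_intros) auto
    have "S = (\<lambda>z. (c$1 + r * (fst z * v$2 + snd z * v$1)) *\<^sub>R axis 1 1
        + (c$2 + r * (snd z * v$2 - fst z * v$1)) *\<^sub>R axis 2 1)"
      by (auto simp: S_def fun_eq_iff vec_eq_iff forall_2 axis_def)
    then show "continuous_on (chorded_circle s t) S"
      by (simp only:) (intro continuous_intros)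
  qed (use KM ST TS in auto)
  then have hom: "K homeomorphic chorded_circle s t" unfolding homeomorphic_def by blast
  show ?thesis
  proof (cases "s < t")
    case True
    then show ?thesis using hom sc(2) tc(2) by (intro exI[of _ s] exI[of _ t]) auto
  next
    case False
    moreover have "chorded_circle s t = chorded_circle t s" by (auto simp: chorded_circle_def)
    ultimately show ?thesis using hom sc(2) tc(2) \<open>s \<noteq> t\<close>
      by (intro exI[of _ t] exI[of _ s]) auto
  qed
qed

section \<open>The embedding of the chorded circle\<close>

text \<open>Stereographic projection of the circle from \<open>(1, 0)\<close>, scaled so that the end points of the chord
  \<open>x = s\<close> go to \<open>\<plusminus>1\<close>. A plain multiple of \<open>y\<close> would not do: the arc to the left of the chord
  may be longer than a semicircle, and then \<open>y\<close> is not injective on it.\<close>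

definition outer :: "real \<Rightarrow> real \<Rightarrow> real \<Rightarrow> real" where
  "outer s x y = y / (1 - x) * ((1 - s) / sqrt (1 - s\<^sup>2))"

lemma height_pos: "- 1 < s \<Longrightarrow> s < 1 \<Longrightarrow> 0 < 1 - (s::real)\<^sup>2"
  using abs_square_less_1[of s] by auto

lemma outer_sq:
  assumes "- 1 < s" "s < 1" "x\<^sup>2 + y\<^sup>2 = 1" "x \<le> s"
  shows "(outer s x y)\<^sup>2 = ((1 + x) / (1 - x)) * ((1 - s) / (1 + s))"
proof -
  have "y\<^sup>2 = (1 + x) * (1 - x)" using assms by (simp add: power2_eq_square algebra_simps)
  then have 1: "(y / (1 - x))\<^sup>2 = (1 + x) / (1 - x)"
    using assms by (simp add: power_divide power2_eq_square)
  have "(sqrt (1 - s\<^sup>2))\<^sup>2 = (1 + s) * (1 - s)"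
    using height_pos[OF assms(1,2)] by (simp add: power2_eq_square algebra_simps)
  then have 2: "((1 - s) / sqrt (1 - s\<^sup>2))\<^sup>2 = (1 - s) / (1 + s)"
    using assms by (simp add: power_divide power2_eq_square)
  show ?thesis unfolding outer_def power_mult_distrib 1 2 ..
qed

lemma outer_bound:
  assumes "- 1 < s" "s < 1" "x\<^sup>2 + y\<^sup>2 = 1" "x < s"
  shows "\<bar>outer s x y\<bar> < 1"
proof -
  have "(1 + x) * (1 - s) < (1 - x) * (1 + s)" using assms by (simp add: algebra_simps)
  then have "(outer s x y)\<^sup>2 < 1"
    using assms by (subst outer_sq) (auto simp: divide_simps)
  then show ?thesis by (simp add: abs_square_less_1)
qed

lemma outer_inj:
  assumes "- 1 < s" "s < 1" "x\<^sup>2 + y\<^sup>2 = 1" "x \<le> s" "x'\<^sup>2 + y'\<^sup>2 = 1" "x' \<le> s"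
    and eq: "outer s x y = outer s x' y'"
  shows "x = x' \<and> y = y'"
proof -
  have "(1 + x) / (1 - x) * ((1 - s) / (1 + s)) = (1 + x') / (1 - x') * ((1 - s) / (1 + s))"
    unfolding outer_sq[OF assms(1-4), symmetric] outer_sq[OF assms(1,2,5,6), symmetric] eq ..
  moreover have "(1 - s) / (1 + s) \<noteq> 0" using assms by simp
  ultimately have "(1 + x) / (1 - x) = (1 + x') / (1 - x')"
    unfolding mult_cancel_right by blast
  then have x: "x = x'" using assms by (simp add: divide_simps) (simp add: algebra_simps)
  then show ?thesis using eq assms height_pos[of s] by (auto simp: outer_def)
qed

lemma outer_surj:
  assumes "- 1 < s" "s < 1" "\<bar>\<tau>\<bar> < 1"
  shows "\<exists>x y. x\<^sup>2 + y\<^sup>2 = 1 \<and> x < s \<and> outer s x y = \<tau>"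
proof -
  define h where "h = sqrt (1 - s\<^sup>2)"
  have h: "h > 0" "h\<^sup>2 = (1 - s) * (1 + s)"
    using height_pos[OF assms(1,2)] by (auto simp: h_def power2_eq_square algebra_simps)
  define \<kappa> where "\<kappa> = \<tau> * h / (1 - s)"
  define x y where "x = (\<kappa>\<^sup>2 - 1) / (\<kappa>\<^sup>2 + 1)" and "y = 2 * \<kappa> / (\<kappa>\<^sup>2 + 1)"
  have pos: "\<kappa>\<^sup>2 + 1 > 0" by (simp add: add_nonneg_pos)
  have "x\<^sup>2 + y\<^sup>2 = ((\<kappa>\<^sup>2 - 1)\<^sup>2 + (2 * \<kappa>)\<^sup>2) / (\<kappa>\<^sup>2 + 1)\<^sup>2"
    by (simp add: x_def y_def power_divide add_divide_distrib)
  also have "(\<kappa>\<^sup>2 - 1)\<^sup>2 + (2 * \<kappa>)\<^sup>2 = (\<kappa>\<^sup>2 + 1)\<^sup>2" by (simp add: power2_eq_square algebra_simps)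
  finally have 1: "x\<^sup>2 + y\<^sup>2 = 1" using pos by simp
  have "\<kappa>\<^sup>2 = \<tau>\<^sup>2 * ((1 + s) / (1 - s))"
    using assms h(2) by (simp add: \<kappa>_def power_mult_distrib power_divide) (simp add: power2_eq_square)
  also have "\<dots> < 1 * ((1 + s) / (1 - s))"
    using assms by (intro mult_strict_right_mono) (auto simp: abs_square_less_1)
  finally have "\<kappa>\<^sup>2 * (1 - s) < 1 + s" using assms by (simp add: field_simps)
  then have 2: "x < s" using pos by (simp add: x_def pos_divide_less_eq algebra_simps)
  have "1 - x = 2 / (\<kappa>\<^sup>2 + 1)" using pos by (simp add: x_def field_simps)
  then have "y / (1 - x) = \<kappa>" using pos by (simp add: y_def)
  then have "outer s x y = \<tau>" using h(1) assms by (simp add: outer_def flip: h_def) (simp add: \<kappa>_def)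
  with 1 2 show ?thesis by blast
qed

lemma compact_chorded_circle: "compact (chorded_circle s t)"
proof -
  have "chorded_circle s t \<subseteq> {-1..1} \<times> {-1..1}"
  proof
    fix p assume "p \<in> chorded_circle s t"
    then obtain x y where p: "p = (x, y)" "x\<^sup>2 + y\<^sup>2 \<le> 1" by (auto simp: chorded_circle_def)
    then have "x\<^sup>2 \<le> 1" "y\<^sup>2 \<le> 1" using zero_le_power2[of x] zero_le_power2[of y] by linarith+
    then show "p \<in> {-1..1} \<times> {-1..1}" using p by (auto simp: abs_square_le_1 abs_le_iff)
  qed
  moreover have "bounded ({-1..1::real} \<times> {-1..1::real})" by (intro bounded_Times) auto
  ultimately have "bounded (chorded_circle s t)" using bounded_subset by blast
  moreover have "closed (chorded_circle s t)"
    unfolding chorded_circle_def case_prod_beta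
    by (intro closed_Collect_disj closed_Collect_conj closed_Collect_eq closed_Collect_le continuous_intros)
  ultimately show ?thesis by (simp add: compact_eq_bounded_closed)
qed

text \<open>The left arc and the left chord go to the two paths from \<open>(-1, 0, 1)\<close> to \<open>(1, 0, -1)\<close> in the first
  triangle, the right chord and the right arc to the two paths from \<open>(-2, -1, 0)\<close> to \<open>(2, -1, 0)\<close> in
  the second one, and the lower and upper middle arcs to the connecting edges.\<close>

definition knotting :: "real \<Rightarrow> real \<Rightarrow> real \<times> real \<Rightarrow> real \<times> real \<times> real" where
  "knotting s t = (\<lambda>(x, y).
     if x < s then (outer s x y, 2 * (1 - \<bar>outer s x y\<bar>), - outer s x y)
     else if x = s then (y / sqrt (1 - s\<^sup>2), 0, - y / sqrt (1 - s\<^sup>2))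
     else if x < t then (sgn y * (1 + (x - s) / (t - s)), - ((x - s) / (t - s)), - sgn y * (1 - (x - s) / (t - s)))
     else if x = t then (2 * y / sqrt (1 - t\<^sup>2), - 1, 0)
     else (2 * outer (- t) (- x) y, 1 - 2 * \<bar>outer (- t) (- x) y\<bar>, 0))"

context
  fixes s t :: real
  assumes st: "- 1 < s" "s < t" "t < 1"
begin

text \<open>The end points of the chords are counted to the chords, so the parameters of the arcs obey strict
  bounds; hence the five cases have disjoint images and injectivity splits into these cases.\<close>

lemma knotting_cases:
  assumes "(x, y) \<in> chorded_circle s t"
  obtains
    (left) \<tau> where "\<tau> = outer s x y" "x < s" "x\<^sup>2 + y\<^sup>2 = 1" "\<bar>\<tau>\<bar> < 1"
      "knotting s t (x, y) = (\<tau>, 2 * (1 - \<bar>\<tau>\<bar>), - \<tau>)"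
  | (chord1) \<tau> where "y = \<tau> * sqrt (1 - s\<^sup>2)" "x = s" "\<bar>\<tau>\<bar> \<le> 1" "knotting s t (x, y) = (\<tau>, 0, - \<tau>)"
  | (middle) \<sigma> \<rho> where "\<rho> = (x - s) / (t - s)" "s < x" "x < t" "x\<^sup>2 + y\<^sup>2 = 1" "\<sigma> = sgn y" "\<sigma> = 1 \<or> \<sigma> = -1"
      "0 < \<rho>" "\<rho> < 1" "knotting s t (x, y) = (\<sigma> * (1 + \<rho>), - \<rho>, - \<sigma> * (1 - \<rho>))"
  | (chord2) \<tau> where "y = \<tau> * sqrt (1 - t\<^sup>2)" "x = t" "\<bar>\<tau>\<bar> \<le> 1" "knotting s t (x, y) = (2 * \<tau>, - 1, 0)"
  | (right) \<tau> where "\<tau> = outer (- t) (- x) y" "t < x" "x\<^sup>2 + y\<^sup>2 = 1" "\<bar>\<tau>\<bar> < 1"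
      "knotting s t (x, y) = (2 * \<tau>, 1 - 2 * \<bar>\<tau>\<bar>, 0)"
proof -
  have frac: "\<bar>y / sqrt (1 - x\<^sup>2)\<bar> \<le> 1" if "-1 < x" "x < 1" "x\<^sup>2 + y\<^sup>2 \<le> 1"
    using that height_pos[of x] by (simp add: real_le_rsqrt)
  consider "x < s" | "x = s" | "s < x" "x < t" | "x = t" | "t < x" by linarith
  then show ?thesis
  proof cases
    case 1
    then have c: "x\<^sup>2 + y\<^sup>2 = 1" using assms st by (auto simp: chorded_circle_def)
    show ?thesis
      by (rule left[OF refl]) (use 1 c outer_bound[of s x y] st in \<open>auto simp: knotting_def\<close>)
  next
    case 2
    then have "x\<^sup>2 + y\<^sup>2 \<le> 1" using assms by (auto simp: chorded_circle_def)
    then show ?thesis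
      using frac 2 st height_pos[of s] by (intro chord1[of "y / sqrt (1 - s\<^sup>2)"]) (auto simp: knotting_def)
  next
    case 3
    then have c: "x\<^sup>2 + y\<^sup>2 = 1" using assms by (auto simp: chorded_circle_def)
    then have "y \<noteq> 0" using 3 st height_pos[of x] by auto
    then show ?thesis
      using 3 c st by (intro middle[of "(x - s) / (t - s)" "sgn y"]) (auto simp: knotting_def sgn_if)
  next
    case 4
    then have "x\<^sup>2 + y\<^sup>2 \<le> 1" using assms by (auto simp: chorded_circle_def)
    then show ?thesis
      using frac 4 st height_pos[of t] by (intro chord2[of "y / sqrt (1 - t\<^sup>2)"]) (auto simp: knotting_def)
  next
    case 5
    then have c: "x\<^sup>2 + y\<^sup>2 = 1" using assms st by (auto simp: chorded_circle_def)
    show ?thesis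
      by (rule right[OF refl]) (use 5 c outer_bound[of "- t" "- x" y] st in \<open>auto simp: knotting_def\<close>)
  qed
qed

lemma inj_knotting: "inj_on (knotting s t) (chorded_circle s t)"
proof (rule inj_onI)
  fix p q assume p: "p \<in> chorded_circle s t" and q: "q \<in> chorded_circle s t"
    and eq: "knotting s t p = knotting s t q"
  obtain x y x' y' where pq: "p = (x, y)" "q = (x', y')" by (metis surj_pair)
  have same_sign: "y = y'" if "x\<^sup>2 + y\<^sup>2 = 1" "x'\<^sup>2 + y'\<^sup>2 = 1" "x = x'" "sgn y = sgn y'"
  proof -
    have "\<bar>y\<bar> = \<bar>y'\<bar>" using that by (metis add_left_cancel power2_eq_iff abs_minus)
    then show ?thesis using that(4) by (metis mult_sgn_abs)
  qed
  note cp = p[unfolded pq(1)] and cq = q[unfolded pq(2)]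
  show "p = q"
    using cp
  proof (cases rule: knotting_cases)
    case p1: (left \<tau>)
    show ?thesis using cq
    proof (cases rule: knotting_cases)
      case (left \<tau>')
      then have "outer s x y = outer s x' y'" using p1 eq by (simp add: pq)
      then show ?thesis using outer_inj[of s x y x' y'] p1 left st by (simp add: pq)
    qed (use p1 eq in \<open>auto simp: pq abs_if split: if_splits\<close>)
  next
    case p2: (chord1 \<tau>)
    show ?thesis using cq
      by (cases rule: knotting_cases) (use p2 eq in \<open>auto simp: pq abs_if split: if_splits\<close>)
  next
    case p3: (middle \<sigma> \<rho>)
    show ?thesis using cq
    proof (cases rule: knotting_cases)
      case (middle \<sigma>' \<rho>')
      then have \<rho>: "\<rho> = \<rho>'" "\<sigma> = \<sigma>'" using p3 eq by (auto simp: pq)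
      then have "x = x'" using p3 middle st by simp
      then show ?thesis using same_sign p3 middle \<rho> by (simp add: pq)
    qed (use p3 eq in \<open>auto simp: pq abs_if split: if_splits\<close>)
  next
    case p4: (chord2 \<tau>)
    show ?thesis using cq
      by (cases rule: knotting_cases) (use p4 eq in \<open>auto simp: pq abs_if split: if_splits\<close>)
  next
    case p5: (right \<tau>)
    show ?thesis using cq
    proof (cases rule: knotting_cases)
      case (right \<tau>')
      then have "outer (- t) (- x) y = outer (- t) (- x') y'" using p5 eq by (simp add: pq)
      then show ?thesis using outer_inj[of "- t" "- x" y "- x'" y'] p5 right st by (simp add: pq)
    qed (use p5 eq in \<open>auto simp: pq abs_if split: if_splits\<close>)
  qed
qed

lemma knotting_chord1:
  assumes "\<bar>\<tau>\<bar> \<le> 1"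
  shows "(\<tau>, 0, - \<tau>) \<in> knotting s t ` chorded_circle s t"
proof -
  have h: "0 < 1 - s\<^sup>2" using height_pos[of s] st by auto
  have "s\<^sup>2 + \<tau>\<^sup>2 * (1 - s\<^sup>2) \<le> s\<^sup>2 + 1 * (1 - s\<^sup>2)"
    using assms abs_square_le_1[of \<tau>] by (intro add_left_mono mult_right_mono less_imp_le[OF h]) blast
  also have "\<dots> = 1" by simp
  finally have "s\<^sup>2 + \<tau>\<^sup>2 * (1 - s\<^sup>2) \<le> 1" .
  then show ?thesis
    using h st by (intro image_eqI[of _ _ "(s, \<tau> * sqrt (1 - s\<^sup>2))"])
      (auto simp: knotting_def chorded_circle_def power_mult_distrib)
qed

lemma knotting_chord2:
  assumes "\<bar>\<tau>\<bar> \<le> 1"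
  shows "(2 * \<tau>, - 1, 0) \<in> knotting s t ` chorded_circle s t"
proof -
  have h: "0 < 1 - t\<^sup>2" using height_pos[of t] st by auto
  have "t\<^sup>2 + \<tau>\<^sup>2 * (1 - t\<^sup>2) \<le> t\<^sup>2 + 1 * (1 - t\<^sup>2)"
    using assms abs_square_le_1[of \<tau>] by (intro add_left_mono mult_right_mono less_imp_le[OF h]) blast
  also have "\<dots> = 1" by simp
  finally have "t\<^sup>2 + \<tau>\<^sup>2 * (1 - t\<^sup>2) \<le> 1" .
  then show ?thesis
    using h st by (intro image_eqI[of _ _ "(t, \<tau> * sqrt (1 - t\<^sup>2))"])
      (auto simp: knotting_def chorded_circle_def power_mult_distrib)
qed

lemma knotting_left:
  assumes "\<bar>\<tau>\<bar> \<le> 1"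
  shows "(\<tau>, 2 * (1 - \<bar>\<tau>\<bar>), - \<tau>) \<in> knotting s t ` chorded_circle s t"
proof (cases "\<bar>\<tau>\<bar> = 1")
  case True
  then show ?thesis using knotting_chord1[of \<tau>] by simp
next
  case False
  then obtain x y where "x\<^sup>2 + y\<^sup>2 = 1" "x < s" "outer s x y = \<tau>"
    using outer_surj[of s \<tau>] st assms by auto
  then show ?thesis
    by (intro image_eqI[of _ _ "(x, y)"]) (auto simp: knotting_def chorded_circle_def)
qed

lemma knotting_right:
  assumes "\<bar>\<tau>\<bar> \<le> 1"
  shows "(2 * \<tau>, 1 - 2 * \<bar>\<tau>\<bar>, 0) \<in> knotting s t ` chorded_circle s t"
proof (cases "\<bar>\<tau>\<bar> = 1")
  case True
  then show ?thesis using knotting_chord2[of \<tau>] by simp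
next
  case False
  then obtain x y where "x\<^sup>2 + y\<^sup>2 = 1" "x < - t" "outer (- t) x y = \<tau>"
    using outer_surj[of "- t" \<tau>] st assms by auto
  then show ?thesis
    using st by (intro image_eqI[of _ _ "(- x, y)"]) (auto simp: knotting_def chorded_circle_def)
qed

lemma knotting_middle:
  assumes "0 \<le> \<rho>" "\<rho> \<le> 1" "\<sigma> = 1 \<or> \<sigma> = -1"
  shows "(\<sigma> * (1 + \<rho>), - \<rho>, - \<sigma> * (1 - \<rho>)) \<in> knotting s t ` chorded_circle s t"
proof -
  consider "\<rho> = 0" | "\<rho> = 1" | "0 < \<rho>" "\<rho> < 1" using assms by linarith
  then show ?thesis
  proof cases
    case 1
    then show ?thesis using knotting_chord1[of \<sigma>] assms by auto
  next
    case 2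
    then show ?thesis using knotting_chord2[of \<sigma>] assms by (auto simp: mult.commute)
  next
    case 3
    define x where "x = s + \<rho> * (t - s)"
    have x: "s < x" "x < t" "(x - s) / (t - s) = \<rho>"
      using 3 st mult_strict_right_mono[of \<rho> 1 "t - s"] unfolding x_def by (auto simp: field_simps)
    have h: "0 < 1 - x\<^sup>2" using height_pos[of x] x st by auto
    have "sgn (\<sigma> * sqrt (1 - x\<^sup>2)) = \<sigma>" "\<sigma>\<^sup>2 = 1" using h assms(3) by (auto simp: sgn_mult)
    then show ?thesis
      using x h by (intro image_eqI[of _ _ "(x, \<sigma> * sqrt (1 - x\<^sup>2))"])
        (auto simp: knotting_def chorded_circle_def power_mult_distrib minus_divide_left[symmetric])
  qed
qed

lemma knotting_image: "knotting s t ` chorded_circle s t = (\<Union>(p, q)\<in>knot_edges. closed_segment p q)"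
proof (intro equalityI subsetI)
  fix z assume "z \<in> knotting s t ` chorded_circle s t"
  then obtain x y where xy: "(x, y) \<in> chorded_circle s t" and z: "z = knotting s t (x, y)" by auto
  show "z \<in> (\<Union>(p, q)\<in>knot_edges. closed_segment p q)"
    using xy
  proof (cases rule: knotting_cases)
    case (left \<tau>)
    show ?thesis
    proof (cases "\<tau> \<le> 0")
      case True
      then show ?thesis unfolding z left(5)
        by (intro in_edgeI[of "(-1, 0, 1)" "(0, 2, 0)" "1 + \<tau>"]) (use left in \<open>auto simp: knot_edges_def\<close>)
    next
      case False
      then show ?thesis unfolding z left(5)
        by (intro in_edgeI[of "(0, 2, 0)" "(1, 0, -1)" \<tau>]) (use left in \<open>auto simp: knot_edges_def\<close>)
    qed
  next
    case (chord1 \<tau>)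
    then show ?thesis unfolding z chord1(4)
      by (intro in_edgeI[of "(-1, 0, 1)" "(1, 0, -1)" "(1 + \<tau>) / 2"]) (auto simp: knot_edges_def field_simps)
  next
    case (middle \<sigma> \<rho>)
    show ?thesis
    proof (cases "\<sigma> = 1")
      case True
      then show ?thesis unfolding z middle(9)
        by (intro in_edgeI[of "(1, 0, -1)" "(2, -1, 0)" \<rho>]) (use middle in \<open>auto simp: knot_edges_def\<close>)
    next
      case False
      then have "\<sigma> = -1" using middle by blast
      then show ?thesis unfolding z middle(9)
        by (intro in_edgeI[of "(-2, -1, 0)" "(-1, 0, 1)" "1 - \<rho>"]) (use middle in \<open>auto simp: knot_edges_def\<close>)
    qed
  next
    case (chord2 \<tau>)
    then show ?thesis unfolding z chord2(4)
      by (intro in_edgeI[of "(-2, -1, 0)" "(2, -1, 0)" "(1 + \<tau>) / 2"]) (auto simp: knot_edges_def field_simps)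
  next
    case (right \<tau>)
    show ?thesis
    proof (cases "\<tau> \<le> 0")
      case True
      then show ?thesis unfolding z right(5)
        by (intro in_edgeI[of "(-2, -1, 0)" "(0, 1, 0)" "1 + \<tau>"]) (use right in \<open>auto simp: knot_edges_def\<close>)
    next
      case False
      then show ?thesis unfolding z right(5)
        by (intro in_edgeI[of "(0, 1, 0)" "(2, -1, 0)" \<tau>]) (use right in \<open>auto simp: knot_edges_def\<close>)
    qed
  qed
next
  fix z assume "z \<in> (\<Union>(p, q)\<in>knot_edges. closed_segment p q)"
  then obtain p q u where e: "(p, q) \<in> knot_edges" and u: "0 \<le> u" "u \<le> 1" and z: "z = (1 - u) *\<^sub>R p + u *\<^sub>R q"
    by (auto simp: in_segment)
  show "z \<in> knotting s t ` chorded_circle s t"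
    using e unfolding knot_edges_def
    apply (elim insertE emptyE)
    subgoal using knotting_chord1[of "2 * u - 1"] u by (simp add: z algebra_simps)
    subgoal using knotting_left[of "u - 1"] u by (simp add: z algebra_simps)
    subgoal using knotting_left[of u] u by (simp add: z algebra_simps)
    subgoal using knotting_chord2[of "2 * u - 1"] u by (simp add: z algebra_simps)
    subgoal using knotting_right[of "u - 1"] u by (simp add: z algebra_simps)
    subgoal using knotting_right[of u] u by (simp add: z algebra_simps)
    subgoal using knotting_middle[of "1 - u" "-1"] u by (simp add: z algebra_simps)
    subgoal using knotting_middle[of u 1] u by (simp add: z algebra_simps)
    done
qed

text \<open>The five formulas agree at the end points of the chords, so they can be read on five closed pieces
  that cover the chorded circle.\<close>

lemma continuous_knotting: "continuous_on (chorded_circle s t) (knotting s t)"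
proof -
  let ?C = "\<lambda>P. {p :: real \<times> real. (fst p)\<^sup>2 + (snd p)\<^sup>2 = 1 \<and> P (fst p)}"
  let ?V = "\<lambda>v. {p :: real \<times> real. (fst p)\<^sup>2 + (snd p)\<^sup>2 \<le> 1 \<and> fst p = v}"
  define A where "A = ?C (\<lambda>x. x \<le> s)"
  define B where "B = ?C (\<lambda>x. s \<le> x \<and> x \<le> t)"
  define C where "C = ?C (\<lambda>x. t \<le> x)"
  have hs: "0 < 1 - s\<^sup>2" and ht: "0 < 1 - t\<^sup>2" using st by (intro height_pos; linarith)+
  have closed: "closed A" "closed B" "closed C" "closed (?V s)" "closed (?V t)"
    unfolding A_def B_def C_def
    by (intro closed_Collect_conj closed_Collect_eq closed_Collect_le continuous_intros)+
  have corner: "y / sqrt (1 - v\<^sup>2) = sgn y" if "v\<^sup>2 + y\<^sup>2 = 1" "0 < 1 - v\<^sup>2" for v y :: real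
  proof -
    have "sqrt (1 - v\<^sup>2) = \<bar>y\<bar>" using that by (metis add_diff_cancel_left' real_sqrt_abs)
    then show ?thesis by (simp add: sgn_div_norm divide_inverse mult.commute)
  qed
  have outer_corner: "outer v v y = y / sqrt (1 - v\<^sup>2)" if "v < 1" for v y
    using that by (simp add: outer_def)
  have sgn_abs: "\<bar>sgn y\<bar> = 1" if "v\<^sup>2 + y\<^sup>2 = 1" "0 < 1 - v\<^sup>2" for v y :: real
    using that by (auto simp: abs_sgn_eq)
  have corner_abs: "\<bar>y\<bar> / sqrt (1 - v\<^sup>2) = 1" if "v\<^sup>2 + y\<^sup>2 = 1" "0 < 1 - v\<^sup>2" for v y :: real
  proof -
    have "sqrt (1 - v\<^sup>2) = \<bar>y\<bar>" using that by (metis add_diff_cancel_left' real_sqrt_abs)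
    then show ?thesis using that by auto
  qed
  have "continuous_on A (knotting s t)"
  proof (rule continuous_on_eq)
    show "continuous_on A (\<lambda>p. (outer s (fst p) (snd p), 2 * (1 - \<bar>outer s (fst p) (snd p)\<bar>), - outer s (fst p) (snd p)))"
      unfolding outer_def using st hs by (intro continuous_intros) (auto simp: A_def)
    show "(outer s (fst p) (snd p), 2 * (1 - \<bar>outer s (fst p) (snd p)\<bar>), - outer s (fst p) (snd p)) = knotting s t p"
      if "p \<in> A" for p
      using that st hs outer_corner[of s "snd p"] corner[of s "snd p"] sgn_abs[of s "snd p"]
      by (cases p) (auto simp: A_def knotting_def)
  qed
  moreover have "continuous_on (?V s) (knotting s t)"
  proof (rule continuous_on_eq)
    show "continuous_on (?V s) (\<lambda>p. (snd p / sqrt (1 - s\<^sup>2), 0, - snd p / sqrt (1 - s\<^sup>2)))"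
      using hs by (intro continuous_intros) auto
  qed (auto simp: knotting_def)
  moreover have "continuous_on B (knotting s t)"
  proof (rule continuous_on_eq)
    have "snd p \<noteq> 0" if "p \<in> B" for p
      using that height_pos[of "fst p"] st by (auto simp: B_def)
    then show "continuous_on B (\<lambda>p. (sgn (snd p) * (1 + (fst p - s) / (t - s)), - ((fst p - s) / (t - s)),
        - sgn (snd p) * (1 - ((fst p - s) / (t - s)))))"
      using st by (intro continuous_intros) auto
    show "(sgn (snd p) * (1 + (fst p - s) / (t - s)), - ((fst p - s) / (t - s)),
        - sgn (snd p) * (1 - ((fst p - s) / (t - s)))) = knotting s t p" if "p \<in> B" for p
      using that st hs ht corner[of s "snd p"] corner[of t "snd p"]
      by (cases p) (auto simp: B_def knotting_def)
  qed
  moreover have "continuous_on (?V t) (knotting s t)"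
  proof (rule continuous_on_eq)
    show "continuous_on (?V t) (\<lambda>p. (2 * snd p / sqrt (1 - t\<^sup>2), - 1, 0))"
      using ht by (intro continuous_intros) auto
  qed (use st in \<open>auto simp: knotting_def\<close>)
  moreover have "continuous_on C (knotting s t)"
  proof (rule continuous_on_eq)
    show "continuous_on C (\<lambda>p. (2 * outer (- t) (- fst p) (snd p), 1 - 2 * \<bar>outer (- t) (- fst p) (snd p)\<bar>, 0))"
      unfolding outer_def using st ht by (intro continuous_intros) (auto simp: C_def)
    show "(2 * outer (- t) (- fst p) (snd p), 1 - 2 * \<bar>outer (- t) (- fst p) (snd p)\<bar>, 0) = knotting s t p"
      if "p \<in> C" for p
      using that st ht outer_corner[of "- t" "snd p"] corner[of t "snd p"] sgn_abs[of t "snd p"] corner_abs[of t "snd p"]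
      by (cases p) (auto simp: C_def knotting_def)
  qed
  ultimately have "continuous_on (A \<union> ?V s \<union> B \<union> ?V t \<union> C) (knotting s t)"
    using closed by (intro continuous_on_closed_Un closed_Un)
  moreover have "chorded_circle s t = A \<union> ?V s \<union> B \<union> ?V t \<union> C"
    by (auto simp: chorded_circle_def A_def B_def C_def)
  ultimately show ?thesis by simp
qed

lemma chorded_circle_homeomorphic_knot_graph:
  assumes "d \<noteq> 0"
  shows "chorded_circle s t homeomorphic knot_graph d"
proof (rule homeomorphic_compact)
  show "continuous_on (chorded_circle s t) (squeeze d \<circ> knotting s t)"
    by (intro continuous_on_compose continuous_knotting linear_continuous_on linear_linear[THEN iffD1] linear_squeeze)
       (simp add: linear_squeeze linear_linear)
  show "(squeeze d \<circ> knotting s t) ` chorded_circle s t = knot_graph d"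
    by (simp only: image_comp[symmetric] knotting_image knot_graph_eq)
  show "inj_on (squeeze d \<circ> knotting s t) (chorded_circle s t)"
    using inj_squeeze[OF assms] by (intro comp_inj_on inj_knotting) (auto intro: inj_on_subset)
qed (rule compact_chorded_circle)

end

section \<open>Counting local minima\<close>

lemma local_minimaE:
  assumes "x \<in> local_minima \<Gamma> u"
  obtains e where "e > 0" "\<forall>z\<in>\<Gamma>. dist z x < e \<longrightarrow> u \<bullet> x \<le> u \<bullet> z"
proof -
  obtain e where "e > 0" "\<forall>z\<in>\<Gamma>. z \<noteq> x \<and> dist z x < e \<longrightarrow> u \<bullet> x \<le> u \<bullet> z"
    using assms unfolding local_minima_def eventually_at by auto
  then have "\<forall>z\<in>\<Gamma>. dist z x < e \<longrightarrow> u \<bullet> x \<le> u \<bullet> z"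
    by (metis order_refl)
  with \<open>e > 0\<close> show ?thesis by (rule that)
qed

text \<open>A linear function with two local minima on a segment is constant on it, and then every point
  of the segment near one of them is a local minimum as well. This is how degenerate directions
  are absorbed: the cardinality there is that of an infinite set, namely \<open>0\<close>.\<close>

lemma infinite_local_minima_if_two_on_segment:
  fixes x y :: "real^3"
  assumes seg: "closed_segment p q \<subseteq> \<Gamma>"
    and x: "x \<in> local_minima \<Gamma> u" "x \<in> closed_segment p q"
    and y: "y \<in> local_minima \<Gamma> u" "y \<in> closed_segment p q"
    and ne: "x \<noteq> y"
  shows "infinite (local_minima \<Gamma> u)"
proof -
  have xy: "closed_segment x y \<subseteq> \<Gamma>"
    using x y seg by (meson closed_segment_subset convex_closed_segment order_trans)
  have le: "u \<bullet> v \<le> u \<bullet> w" if v: "v \<in> local_minima \<Gamma> u" and vw: "closed_segment v w \<subseteq> \<Gamma>" for v w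
  proof (cases "v = w")
    case False
    obtain e where e: "e > 0" "\<forall>z\<in>\<Gamma>. dist z v < e \<longrightarrow> u \<bullet> v \<le> u \<bullet> z"
      using v by (rule local_minimaE)
    define t where "t = min 1 (e / (2 * norm (w - v)))"
    have n: "norm (w - v) > 0" using False by simp
    have t: "0 < t" "t \<le> 1" using n e by (auto simp: t_def)
    have "v + t *\<^sub>R (w - v) \<in> closed_segment v w"
      using t by (auto simp: in_segment algebra_simps intro!: exI[of _ t])
    moreover have "t * norm (w - v) \<le> e / 2"
    proof -
      have "t * norm (w - v) \<le> e / (2 * norm (w - v)) * norm (w - v)"
        using n by (intro mult_right_mono) (auto simp: t_def)
      then show ?thesis using n by simp
    qed
    then have "dist (v + t *\<^sub>R (w - v)) v < e"
      using t e by (simp add: dist_norm)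
    ultimately have "u \<bullet> v \<le> u \<bullet> (v + t *\<^sub>R (w - v))" using e vw by blast
    then have "0 \<le> t * (u \<bullet> w - u \<bullet> v)" by (simp add: inner_add_right inner_diff_right)
    then show ?thesis using t by (simp add: zero_le_mult_iff)
  qed simp
  have eq: "u \<bullet> x = u \<bullet> y"
    using le[of x y] le[of y x] x y xy by (simp add: closed_segment_commute)
  obtain e where e: "e > 0" "\<forall>z\<in>\<Gamma>. dist z x < e \<longrightarrow> u \<bullet> x \<le> u \<bullet> z"
    using x(1) by (rule local_minimaE)
  have "closed_segment x y \<inter> ball x e \<subseteq> local_minima \<Gamma> u"
  proof
    fix z assume z: "z \<in> closed_segment x y \<inter> ball x e"
    then have uz: "u \<bullet> z = u \<bullet> x"
    proof -
      obtain r where "z = (1 - r) *\<^sub>R x + r *\<^sub>R y" using z by (auto simp: in_segment)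
      then have "u \<bullet> z = (1 - r) * (u \<bullet> x) + r * (u \<bullet> y)" by (simp add: inner_add_right)
      then show ?thesis using eq by (simp add: algebra_simps)
    qed
    have "\<forall>\<^sub>F w in at z within \<Gamma>. u \<bullet> z \<le> u \<bullet> w"
      unfolding eventually_at
    proof (intro exI[of _ "e - dist x z"] conjI ballI impI)
      show "e - dist x z > 0" using z by auto
      fix w assume "w \<in> \<Gamma>" "w \<noteq> z \<and> dist w z < e - dist x z"
      then have "dist w x < e" using dist_triangle[of w x z] by (simp add: dist_commute)
      then show "u \<bullet> z \<le> u \<bullet> w" using e \<open>w \<in> \<Gamma>\<close> uz by simp
    qed
    then show "z \<in> local_minima \<Gamma> u"
      using z xy by (auto simp: local_minima_def)
  qed
  moreover have "infinite (closed_segment x y \<inter> ball x e)"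
  proof -
    have "x islimpt closed_segment x y"
      using ne by (auto intro!: connected_imp_perfect simp: closed_segment_eq_sing)
    then show ?thesis
      using \<open>e > 0\<close> by (simp add: islimpt_eq_infinite_ball)
  qed
  ultimately show ?thesis using finite_subset by blast
qed

text \<open>Unless there are infinitely many local minima, each segment carries at most one.\<close>

lemma card_local_minima_le:
  fixes E :: "((real^3) \<times> (real^3)) set"
  assumes "finite E" "\<Gamma> = (\<Union>(p, q)\<in>E. closed_segment p q)"
  shows "card (local_minima \<Gamma> u) \<le> card E"
proof (cases "finite (local_minima \<Gamma> u)")
  case True
  have "\<forall>x\<in>local_minima \<Gamma> u. \<exists>e\<in>E. x \<in> closed_segment (fst e) (snd e)"
    using assms by (force simp: local_minima_def)
  then obtain h where h: "\<And>x. x \<in> local_minima \<Gamma> u \<Longrightarrow> h x \<in> E \<and> x \<in> closed_segment (fst (h x)) (snd (h x))"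
    by metis
  have "inj_on h (local_minima \<Gamma> u)"
  proof (rule inj_onI, rule ccontr)
    fix x y assume xy: "x \<in> local_minima \<Gamma> u" "y \<in> local_minima \<Gamma> u" "h x = h y" "x \<noteq> y"
    have "closed_segment (fst (h x)) (snd (h x)) \<subseteq> \<Gamma>"
      using h[OF xy(1)] assms by force
    moreover have "y \<in> closed_segment (fst (h x)) (snd (h x))"
      using h[OF xy(2)] xy(3) by simp
    ultimately show False
      using infinite_local_minima_if_two_on_segment[of "fst (h x)" "snd (h x)" \<Gamma> x u y] xy(1,2,4) h[OF xy(1)] True by blast
  qed
  then show ?thesis using card_inj_on_le[of h] h assms by blast
qed simp

text \<open>A point of a strictly ascending edge other than its start has lower points of the same edge
  arbitrarily close to it.\<close>

lemma local_minima_subset_sources: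
  fixes E :: "((real^3) \<times> (real^3)) set"
  assumes \<Gamma>: "\<Gamma> = (\<Union>(p, q)\<in>E. closed_segment p q)"
    and up: "\<And>p q. (p, q) \<in> E \<Longrightarrow> u \<bullet> p < u \<bullet> q"
  shows "local_minima \<Gamma> u \<subseteq> fst ` E - snd ` E"
proof
  fix x assume x: "x \<in> local_minima \<Gamma> u"
  obtain e where e: "e > 0" "\<forall>z\<in>\<Gamma>. dist z x < e \<longrightarrow> u \<bullet> x \<le> u \<bullet> z"
    using x by (rule local_minimaE)
  have start: "x = p" if E: "(p, q) \<in> E" and xs: "x \<in> closed_segment p q" for p q
  proof (rule ccontr)
    assume ne: "x \<noteq> p"
    obtain s where s: "0 \<le> s" "s \<le> 1" "x = (1 - s) *\<^sub>R p + s *\<^sub>R q"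
      using xs by (auto simp: in_segment)
    have "s > 0" using s ne by (cases "s = 0") auto
    have "x \<in> closed_segment p x" by simp
    have "p islimpt closed_segment p x \<and> x islimpt closed_segment p x"
      using ne by (auto intro!: connected_imp_perfect simp: closed_segment_eq_sing)
    then obtain z where z: "z \<in> closed_segment p x" "z \<noteq> x" "dist z x < e"
      using e islimpt_approachable by metis
    have "closed_segment p x \<subseteq> closed_segment p q" using xs by (simp add: subset_closed_segment)
    then have "z \<in> \<Gamma>" using z E \<Gamma> by blast
    obtain r where r: "0 \<le> r" "r \<le> 1" "z = (1 - r) *\<^sub>R p + r *\<^sub>R x"
      using z by (auto simp: in_segment)
    have "r < 1" using r z by (cases "r = 1") auto
    have px: "u \<bullet> p < u \<bullet> x"
    proof -
      have "u \<bullet> x = u \<bullet> p + s * (u \<bullet> q - u \<bullet> p)"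
        unfolding s by (simp add: inner_add_right algebra_simps)
      then show ?thesis using up[OF E] \<open>s > 0\<close> by simp
    qed
    have "u \<bullet> z = u \<bullet> x - (1 - r) * (u \<bullet> x - u \<bullet> p)"
      unfolding r by (simp add: inner_add_right algebra_simps)
    then have "u \<bullet> z < u \<bullet> x" using px \<open>r < 1\<close> by simp
    with e z \<open>z \<in> \<Gamma>\<close> show False by force
  qed
  obtain p q where pq: "(p, q) \<in> E" "x \<in> closed_segment p q"
    using x \<Gamma> by (auto simp: local_minima_def)
  have "x \<notin> snd ` E"
  proof
    assume "x \<in> snd ` E"
    then obtain r where r: "(r, x) \<in> E" by force
    then have "x = r" using start[of r x] by simp
    with up[OF r] show False by simp
  qed
  moreover have "x \<in> fst ` E" using start[OF pq] pq by force
  ultimately show "x \<in> fst ` E - snd ` E" by blast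
qed

section \<open>Integrating over the sphere\<close>

text \<open>On the unit sphere \<open>B\<close> lies in the band of points of height at most \<open>4 * d\<close>, which has
  area \<open>16 * pi * d\<close> by Archimedes. The condition on \<open>B\<close> is homogeneous in \<open>u\<close>, because directions enter
  only through the sign of their inner products with the edges.\<close>

lemma nn_integral_sphere_equatorial_band:
  fixes d :: real and N :: nat
  assumes d: "0 < d" "d < 1/4"
    and B: "B \<in> sets borel" "\<And>u. u \<in> B \<Longrightarrow> \<bar>u $ 3\<bar> \<le> 2 * d * (\<bar>u $ 1\<bar> + \<bar>u $ 2\<bar>)"
  shows "(\<integral>\<^sup>+ u. 1 + of_nat N * indicator B u \<partial>sphere_area) \<le> ennreal (4 * pi * (1 + 4 * d * N))"
proof -
  define \<alpha> where "\<alpha> = arccos (4 * d)"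
  have \<alpha>: "cos \<alpha> = 4 * d" "0 \<le> \<alpha>" "\<alpha> \<le> pi" "\<alpha> \<le> pi - \<alpha>"
    using d arccos_le_pi2[of "4 * d"] unfolding \<alpha>_def by (auto simp: arccos_lbound arccos_ubound)
  have band: "\<theta> \<in> {\<alpha>..pi - \<alpha>}" if \<theta>: "\<theta> \<in> {0..pi}" and b: "spherical_coords (\<theta>, \<phi>) \<in> B" for \<theta> \<phi>
  proof -
    have s: "0 \<le> sin \<theta>" "sin \<theta> \<le> 1" using \<theta> by (auto intro: sin_ge_zero)
    have "\<bar>cos \<theta>\<bar> \<le> 2 * d * (\<bar>sin \<theta> * cos \<phi>\<bar> + \<bar>sin \<theta> * sin \<phi>\<bar>)"
      using B(2)[OF b] by (simp add: spherical_coords_def)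
    also have "\<bar>sin \<theta> * cos \<phi>\<bar> + \<bar>sin \<theta> * sin \<phi>\<bar> \<le> 1 + 1"
      using s by (intro add_mono) (auto simp: abs_mult intro!: mult_le_one)
    finally have c: "\<bar>cos \<theta>\<bar> \<le> 4 * d" using d by (simp add: mult_left_mono)
    have "\<alpha> \<le> \<theta>"
    proof (rule ccontr)
      assume "\<not> ?thesis"
      then have "cos \<alpha> < cos \<theta>" using \<theta> \<alpha> by (intro cos_monotone_0_pi) auto
      with c \<alpha> show False by simp
    qed
    moreover have "\<theta> \<le> pi - \<alpha>"
    proof (rule ccontr)
      assume "\<not> ?thesis"
      then have "cos \<theta> < cos (pi - \<alpha>)" using \<theta> \<alpha> by (intro cos_monotone_0_pi) auto
      with c \<alpha> show False by simp
    qed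
    ultimately show ?thesis by simp
  qed
  have [measurable]: "B \<in> sets borel" by fact
  have [measurable]: "indicator B \<in> borel_measurable (borel :: (real^3) measure)"
    by measurable
  have "(\<integral>\<^sup>+ u. indicator B u \<partial>sphere_area) =
    (\<integral>\<^sup>+ \<theta>\<in>{0..pi}. (\<integral>\<^sup>+ \<phi>\<in>{0..2 * pi}. indicator B (spherical_coords (\<theta>, \<phi>)) \<partial>lborel) * ennreal (sin \<theta>) \<partial>lborel)"
    by (rule nn_integral_sphere_area) measurable
  also have "\<dots> \<le> (\<integral>\<^sup>+ \<theta>\<in>{\<alpha>..pi - \<alpha>}. ennreal (2 * pi * sin \<theta>) \<partial>lborel)"
  proof (rule nn_integral_mono)
    fix \<theta> :: real
    show "(\<integral>\<^sup>+ \<phi>\<in>{0..2 * pi}. indicator B (spherical_coords (\<theta>, \<phi>)) \<partial>lborel) * ennreal (sin \<theta>)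
        * indicator {0..pi} \<theta> \<le> ennreal (2 * pi * sin \<theta>) * indicator {\<alpha>..pi - \<alpha>} \<theta>"
    proof (cases "\<theta> \<in> {0..pi}")
      case True
      show ?thesis
      proof (cases "\<theta> \<in> {\<alpha>..pi - \<alpha>}")
        case False
        then have "indicator B (spherical_coords (\<theta>, \<phi>)) = (0::ennreal)" for \<phi>
          using band[OF True] by (auto simp: indicator_def)
        then show ?thesis by simp
      next
        case ab: True
        have "(\<integral>\<^sup>+ \<phi>\<in>{0..2 * pi}. indicator B (spherical_coords (\<theta>, \<phi>)) \<partial>lborel)
            \<le> (\<integral>\<^sup>+ \<phi>\<in>{0..2 * pi}. 1 \<partial>lborel)"
          by (intro nn_integral_mono) (auto simp: indicator_def)
        also have "\<dots> = ennreal (2 * pi)" by simp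
        finally have "(\<integral>\<^sup>+ \<phi>\<in>{0..2 * pi}. indicator B (spherical_coords (\<theta>, \<phi>)) \<partial>lborel) * ennreal (sin \<theta>)
          \<le> ennreal (2 * pi) * ennreal (sin \<theta>)" by (rule mult_right_mono) simp
        also have "\<dots> = ennreal (2 * pi * sin \<theta>)" by (simp add: ennreal_mult')
        finally show ?thesis using True ab by simp
      qed
    qed simp
  qed
  also have "\<dots> = ennreal (- (2 * pi) * cos (pi - \<alpha>) - (- (2 * pi) * cos \<alpha>))"
  proof (rule nn_integral_FTC_Icc)
    show "0 \<le> 2 * pi * sin x" if "x \<in> {\<alpha>..pi - \<alpha>}" for x
      using that \<alpha> by (intro mult_nonneg_nonneg sin_ge_zero) auto
    show "((\<lambda>x. - (2 * pi) * cos x) has_real_derivative 2 * pi * sin x) (at x)" for x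
      by (auto intro!: derivative_eq_intros)
  qed (use \<alpha> in auto)
  also have "\<dots> = ennreal (16 * pi * d)"
    using \<alpha> by (simp add: algebra_simps)
  finally have ind: "(\<integral>\<^sup>+ u. indicator B u \<partial>sphere_area) \<le> ennreal (16 * pi * d)" .
  have [simp]: "sets sphere_area = sets borel" by (simp add: sphere_area_def)
  have "(\<integral>\<^sup>+ u. 1 + of_nat N * indicator B u \<partial>sphere_area)
      = emeasure sphere_area UNIV + of_nat N * (\<integral>\<^sup>+ u. indicator B u \<partial>sphere_area)"
    using B(1) by (simp add: nn_integral_add nn_integral_cmult sphere_area_def)
  also have "\<dots> \<le> ennreal (4 * pi) + ennreal (real N) * ennreal (16 * pi * d)"
    unfolding emeasure_sphere_area by (intro add_mono mult_mono ind) (auto simp: ennreal_of_nat_eq_real_of_nat)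
  also have "\<dots> = ennreal (4 * pi * (1 + 4 * d * N))"
    using d by (simp flip: ennreal_mult ennreal_plus add: algebra_simps)
  finally show ?thesis .
qed

section \<open>Crookedness of the squeezed graph\<close>

text \<open>For a direction outside the band around the equator all edges ascend or all descend, so that only
  one end of the graph can be a local minimum. In the band the number of edges bounds the number of
  minima; the excess over 1 is at most 7 and is weighted by the share \<open>4 * d\<close> of the band.\<close>

lemma crookedness_knot_graph:
  assumes d: "0 < d" "d < 1/4"
  shows "crookedness (knot_graph d) \<le> ennreal (1 + 28 * d)"
proof -
  let ?E = "map_prod (squeeze d) (squeeze d) ` knot_edges"
  define B :: "(real^3) set" where "B = {u. \<bar>u $ 3\<bar> \<le> 2 * d * (\<bar>u $ 1\<bar> + \<bar>u $ 2\<bar>)}"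
  have fin: "finite ?E" by (simp add: knot_edges_def)
  have "card ?E \<le> card knot_edges" by (rule card_image_le) (simp add: knot_edges_def)
  also have "\<dots> = 8" by (simp add: knot_edges_def)
  finally have all: "card (local_minima (knot_graph d) u) \<le> 8" for u
    using card_local_minima_le[OF fin knot_graph_def, of u] by simp
  have rev: "knot_graph d = (\<Union>(p, q)\<in>prod.swap ` ?E. closed_segment p q)"
    by (auto simp: knot_graph_def closed_segment_commute)
  have good: "card (local_minima (knot_graph d) u) \<le> 1" if u: "u \<notin> B" for u
  proof -
    have bounds: "\<bar>d * u$1\<bar> = d * \<bar>u$1\<bar>" "\<bar>d * u$2\<bar> = d * \<bar>u$2\<bar>" using d by (simp_all add: abs_mult)
    have u': "2 * \<bar>d * u$1\<bar> + 2 * \<bar>d * u$2\<bar> < \<bar>u$3\<bar>"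
      using u by (simp add: B_def bounds algebra_simps)
    have prods: "u \<bullet> squeeze d (x, y, z) = y * (d * u$1) + z * (d * u$2) + x * u$3" for x y z
      by (simp add: inner_vec_def sum_3 mult_ac)
    have "\<exists>v. local_minima (knot_graph d) u \<subseteq> {v}"
    proof (cases "u$3 > 0")
      case True
      have "local_minima (knot_graph d) u \<subseteq> fst ` ?E - snd ` ?E"
      proof (rule local_minima_subset_sources[OF knot_graph_def])
        fix p q assume "(p, q) \<in> ?E"
        then show "u \<bullet> p < u \<bullet> q"
          using u' True unfolding knot_edges_def by (auto simp: prods)
      qed
      also have "\<dots> \<subseteq> {squeeze d (-2, -1, 0)}"
        by (auto simp: knot_edges_def)
      finally show ?thesis by blast
    next
      case False
      have "local_minima (knot_graph d) u \<subseteq> fst ` prod.swap ` ?E - snd ` prod.swap ` ?E"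
      proof (rule local_minima_subset_sources[OF rev])
        fix p q assume "(p, q) \<in> prod.swap ` ?E"
        then show "u \<bullet> p < u \<bullet> q"
          using u' False unfolding knot_edges_def by (auto simp: prods)
      qed
      also have "\<dots> \<subseteq> {squeeze d (2, -1, 0)}"
        by (auto simp: knot_edges_def)
      finally show ?thesis by blast
    qed
    then obtain v where "local_minima (knot_graph d) u \<subseteq> {v}" by blast
    then show ?thesis using card_mono[of "{v}"] by force
  qed
  have le: "of_nat (card (local_minima (knot_graph d) u)) \<le> (1 + of_nat 7 * indicator B u :: ennreal)" for u
  proof (cases "u \<in> B")
    case True
    have "(of_nat (card (local_minima (knot_graph d) u)) :: ennreal) \<le> of_nat 8"
      using all[of u] by (simp only: of_nat_le_iff)
    then show ?thesis using True by simp
  next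
    case False
    have "(of_nat (card (local_minima (knot_graph d) u)) :: ennreal) \<le> of_nat 1"
      using good[OF False] by (simp only: of_nat_le_iff)
    then show ?thesis using False by simp
  qed
  have "closed B"
    unfolding B_def by (intro closed_Collect_le continuous_intros)
  then have "(\<integral>\<^sup>+ u. 1 + of_nat 7 * indicator B u \<partial>sphere_area) \<le> ennreal (4 * pi * (1 + 4 * d * real 7))"
    using d by (intro nn_integral_sphere_equatorial_band) (auto simp: B_def)
  then have "(\<integral>\<^sup>+ u. of_nat (card (local_minima (knot_graph d) u)) \<partial>sphere_area) \<le> ennreal (4 * pi * (1 + 4 * d * real 7))"
    using nn_integral_mono[of sphere_area, OF le] by (rule order_trans[rotated])
  then have "crookedness (knot_graph d) \<le> ennreal (4 * pi * (1 + 4 * d * real 7)) / ennreal (4 * pi)"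
    unfolding crookedness_def by (rule divide_right_mono_ennreal)
  also have "\<dots> = ennreal (1 + 28 * d)"
    using d by (subst divide_ennreal) auto
  finally show ?thesis .
qed

section \<open>The theorem\<close>

theorem mainTheorem5:
  fixes G :: "'a::topological_space set" and K :: "(real^2) set"
  assumes "circle_with_two_parallel_chords K"
    and "G homeomorphic K"
  shows "\<forall>\<epsilon>>0::real. \<exists>f :: 'a \<Rightarrow> real^3.
           pl_embedding_on G f \<and> knotted_on G f \<and> crookedness (f ` G) < ennreal (1 + \<epsilon>)"
proof (intro allI impI)
  fix \<epsilon> :: real assume \<epsilon>: "\<epsilon> > 0"
  define d where "d = min (1/8) (\<epsilon> / 56)"
  have d: "0 < d" "d < 1/4" "28 * d < \<epsilon>" using \<epsilon> by (auto simp: d_def)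
  obtain s t where st: "- 1 < s" "s < t" "t < 1" "K homeomorphic chorded_circle s t"
    using circle_with_two_parallel_chords_homeomorphic[OF assms(1)] by blast
  have "chorded_circle s t homeomorphic knot_graph d"
    by (rule chorded_circle_homeomorphic_knot_graph) (use st d in auto)
  then have "G homeomorphic knot_graph d"
    by (rule homeomorphic_trans[OF homeomorphic_trans[OF assms(2) st(4)]])
  then obtain f g where fg: "homeomorphism G (knot_graph d) f g"
    unfolding homeomorphic_def by blast
  then have img: "f ` G = knot_graph d" by (simp add: homeomorphism_def)
  have emb: "embedding_on G f" unfolding embedding_on_def img using fg by blast
  define E where "E = map_prod (squeeze d) (squeeze d) ` knot_edges"
  have \<Gamma>: "knot_graph d = (\<Union>e\<in>E. closed_segment (fst e) (snd e))"
    unfolding knot_graph_def E_def case_prod_beta ..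
  have finE: "finite E" by (simp add: E_def knot_edges_def)
  let ?\<A> = "(\<lambda>e. {x \<in> G. f x \<in> closed_segment (fst e) (snd e)}) ` E"
  have "pl_embedding_on G f"
    unfolding pl_embedding_on_def
  proof (intro conjI exI[of _ ?\<A>] emb ballI)
    show "finite ?\<A>" using finE by simp
    show "\<Union> ?\<A> = G" using img unfolding \<Gamma> by blast
    fix A assume "A \<in> ?\<A>"
    then obtain e where e: "e \<in> E" "A = {x \<in> G. f x \<in> closed_segment (fst e) (snd e)}" by blast
    have "closed_segment (fst e) (snd e) \<subseteq> f ` G" using e(1) unfolding img \<Gamma> by blast
    then have "f ` A = closed_segment (fst e) (snd e)" using e(2) by blast
    then show "\<exists>x y. f ` A = closed_segment x y" by blast
  qed
  moreover have "knotted_on G f"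
    unfolding knotted_on_def
  proof (intro conjI emb notI)
    assume "\<exists>g. planar_embedding_on G g \<and> ambient_isotopic_on G f g"
    then obtain g \<Phi> P where P: "affine P" "aff_dim P = 2" "g ` G \<subseteq> P"
      and \<Phi>: "homotopic_with_canon (\<lambda>h. \<exists>k. homeomorphism UNIV UNIV h k) UNIV UNIV id \<Phi>"
      and g: "\<forall>x\<in>G. g x = \<Phi> (f x)"
      unfolding planar_embedding_on_def ambient_isotopic_on_def by blast
    obtain \<Psi> where "homeomorphism UNIV UNIV \<Phi> \<Psi>"
      using homotopic_with_imp_property[OF \<Phi>] by blast
    moreover have "P \<noteq> UNIV" using P(2) by (auto simp: aff_dim_UNIV)
    ultimately have "\<not> \<Phi> ` knot_graph d \<subseteq> P"
      using knot_graph_not_planar d(1) P(1) by blast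
    moreover have "\<Phi> ` knot_graph d \<subseteq> P" using P(3) g unfolding img[symmetric] by auto
    ultimately show False by blast
  qed
  moreover have "crookedness (f ` G) < ennreal (1 + \<epsilon>)"
    unfolding img using crookedness_knot_graph[OF d(1,2)] d \<epsilon>
    by (rule_tac order_le_less_trans) (auto simp: ennreal_less_iff)
  ultimately show "\<exists>f :: 'a \<Rightarrow> real^3. pl_embedding_on G f \<and> knotted_on G f \<and> crookedness (f ` G) < ennreal (1 + \<epsilon>)"
    by blast
qed

end
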